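(* Let $q>3$ be a prime power, $m\geq q$, and $n=\frac{q^m-1}{q-1}$. Write $m-1=a(q-1)+b$ with integers $a\geq 1$ and $0\leq b\leq q-2$, and suppose that either ($b=0$ and $a\geq 3$) or $b\in\{1,2,q-4,q-3,q-2\}$. Let $\delta_{1,n}$ and $\delta_{2,n}$ be the largest and second largest $q$-cyclotomic coset leaders modulo $n$. Then for $\delta_{2,n}+1\leq\delta\leq\delta_{1,n}$ the BCH code $\mathcal{C}_{(q,n,\delta)}$ has length $n$, dimension $\frac{m}{\gcd(m,q-1)}+1$ and minimum distance $d\geq\delta$; and the BCH code $\mathcal{C}_{(q,n,\delta_{2,n})}$ has length $n$, dimension $\frac{m}{\gcd(m,q-1)}+m+1$ and minimum distance $d\geq\delta_{2,n}$.
   Context: Let $\alpha$ be a generator of $\mathbb{F}_{q^{m}}^*$ and $\beta_2=\alpha^{q-1}$, a primitive $n$-th root of unity. For an integer $j$ let $m_j(x)$ be the minimal polynomial of $\beta_2^j$ over $\mathbb{F}_q$. For $2\le\delta\le n$, the narrow-sense BCH code $\mathcal{C}_{(q,n,\delta)}$ is the cyclic code of length $n$ over $\mathbb{F}_q$ (an ideal of $\mathbb{F}_q[x]/\langle x^n-1\rangle$) generated by $\mathrm{lcm}(m_1(x),\dots,m_{\delta-1}(x))$. The $q$-cyclotomic coset of $t$ modulo $n$ is $C_t=\{tq^j\bmod n: 0\le j<m\}$; its smallest element is its coset leader; $\delta_{i,n}$ denotes the $i$-th largest $q$-cyclotomic coset leader modulo $n$. *)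

theory Defs
  imports
    "HOL-Computational_Algebra.Computational_Algebra"
    "HOL-Number_Theory.Prime_Powers"
    "HOL-Library.Cardinality"
    "Subresultants.More_Homomorphisms"
begin

definition cyclotomic_coset :: "nat \<Rightarrow> nat \<Rightarrow> nat \<Rightarrow> nat \<Rightarrow> nat set" where
  "cyclotomic_coset q m n t = {t * q ^ j mod n |j. j < m}"

definition coset_leaders :: "nat \<Rightarrow> nat \<Rightarrow> nat \<Rightarrow> nat set" where
  "coset_leaders q m n = {Min (cyclotomic_coset q m n t) |t. t < n}"

text \<open>The index \<open>i\<close> is counted from 1, so \<open>i = 1\<close> gives the largest coset leader.\<close>

definition nth_largest_leader :: "nat \<Rightarrow> nat \<Rightarrow> nat \<Rightarrow> nat \<Rightarrow> nat" where
  "nth_largest_leader q m n i = rev (sorted_list_of_set (coset_leaders q m n)) ! (i - 1)"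

definition mult_generator :: "'l::field \<Rightarrow> bool" where
  "mult_generator \<alpha> \<longleftrightarrow> range (\<lambda>k::nat. \<alpha> ^ k) = UNIV - {0}"

text \<open>
  The base field is a type \<open>'k\<close>, its extension a type \<open>'l\<close>, and the inclusion a field
  homomorphism \<open>h\<close> from \<open>'k\<close> to \<open>'l\<close>.
\<close>

definition min_poly :: "('k::field \<Rightarrow> 'l::field) \<Rightarrow> 'l \<Rightarrow> 'k poly" where
  "min_poly h x = (THE p. lead_coeff p = 1 \<and> poly (map_poly h p) x = 0 \<and>
     (\<forall>r. r \<noteq> 0 \<longrightarrow> poly (map_poly h r) x = 0 \<longrightarrow> degree p \<le> degree r))"

text \<open>
  The library's \<^const>\<open>Lcm\<close> on polynomials is only available over coefficient types of class
  \<^class>\<open>field_gcd\<close>. The following version needs only \<^class>\<open>field\<close>; lemma \<open>monic_Lcm_eq_Lcm\<close>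
  shows that the two agree where both are defined.
\<close>

definition monic_Lcm :: "'k::field poly set \<Rightarrow> 'k poly" where
  "monic_Lcm P = (THE g. lead_coeff g = 1 \<and> (\<forall>p\<in>P. p dvd g) \<and>
     (\<forall>f. (\<forall>p\<in>P. p dvd f) \<longrightarrow> g dvd f))"

lemma monic_Lcm_eq_Lcm:
  fixes P :: "'k::field_gcd poly set"
  assumes "finite P" "0 \<notin> P"
  shows "monic_Lcm P = Lcm P"
proof -
  have unit: "unit_factor a = a" if "a \<noteq> 0" for a :: 'k
    using that by (simp add: is_unit_unit_factor dvd_field_iff)
  have nz: "Lcm P \<noteq> 0"
    using assms by (simp add: Lcm_0_iff)
  have "unit_factor (Lcm P) = 1"
    using nz by (simp add: unit_factor_Lcm)
  hence lc: "lead_coeff (Lcm P) = 1"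
    using nz by (simp add: unit_factor_poly_def unit monom_eq_1_iff flip: one_pCons)
  show ?thesis
    unfolding monic_Lcm_def
  proof (rule the_equality)
    show "lead_coeff (Lcm P) = 1 \<and> (\<forall>p\<in>P. p dvd Lcm P) \<and>
      (\<forall>f. (\<forall>p\<in>P. p dvd f) \<longrightarrow> Lcm P dvd f)"
      using lc by (auto intro: Lcm_least dvd_Lcm)
  next
    fix g assume g: "lead_coeff g = 1 \<and> (\<forall>p\<in>P. p dvd g) \<and> (\<forall>f. (\<forall>p\<in>P. p dvd f) \<longrightarrow> g dvd f)"
    hence "g dvd Lcm P" "Lcm P dvd g"
      by (auto intro: Lcm_least dvd_Lcm)
    thus "g = Lcm P"
      using g lc by (intro poly_dvd_antisym) auto
  qed
qed

text \<open>
  A word \<open>(c\<^sub>0, \<dots>, c\<^sub>n\<^sub>-\<^sub>1)\<close> is identified with the polynomial \<open>c\<^sub>0 + c\<^sub>1 x + \<dots> + c\<^sub>n\<^sub>-\<^sub>1 x\<^sup>n\<^sup>-\<^sup>1\<close>, and a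
  residue class modulo \<open>x\<^sup>n - 1\<close> with its representative of degree less than \<open>n\<close>.
\<close>

lemma vector_space_smult: "vector_space (Polynomial.smult :: 'k::field \<Rightarrow> 'k poly \<Rightarrow> 'k poly)"
  by unfold_locales (simp_all add: smult_add_right smult_add_left)

definition linear_code :: "nat \<Rightarrow> 'k::field poly set \<Rightarrow> bool" where
  "linear_code n C \<longleftrightarrow> module.subspace Polynomial.smult C \<and> (\<forall>c\<in>C. \<forall>i\<ge>n. coeff c i = 0)"

definition code_dim :: "'k::field poly set \<Rightarrow> nat" where
  "code_dim C = vector_space.dim Polynomial.smult C"

definition hamming_dist :: "'k::field poly \<Rightarrow> 'k poly \<Rightarrow> nat" where
  "hamming_dist c d = card {i. coeff c i \<noteq> coeff d i}"

definition min_dist :: "'k::field poly set \<Rightarrow> nat" where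
  "min_dist C = Min {hamming_dist c d |c d. c \<in> C \<and> d \<in> C \<and> c \<noteq> d}"

text \<open>The ideal of \<open>K[x] / (x\<^sup>n - 1)\<close> generated by the class of \<open>g\<close>.\<close>

definition cyclic_code :: "nat \<Rightarrow> 'k::field poly \<Rightarrow> 'k poly set" where
  "cyclic_code n g = {(g * f) mod (monom 1 n - 1) |f. True}"

definition bch_code :: "('k::field \<Rightarrow> 'l::field) \<Rightarrow> nat \<Rightarrow> 'l \<Rightarrow> nat \<Rightarrow> 'k poly set" where
  "bch_code h n \<beta> \<delta> = cyclic_code n (monic_Lcm ((\<lambda>j. min_poly h (\<beta> ^ j)) ` {1..\<delta> - 1}))"

end

theory Submission
  imports Defs "HOL-Number_Theory.Cong"
begin

text \<open>
  Multiplying a residue modulo \<open>n\<close> by \<open>q\<close> rotates the \<open>m\<close> base-\<open>q\<close> digits of \<open>s / n\<close>, and the residues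
  correspond to the words whose digit sum is a multiple \<open>K (q - 1)\<close> of \<open>q - 1\<close>. Passing from \<open>t\<close> to
  \<open>s = n - t\<close> turns coset leaders into coset maxima, so the largest leaders are the smallest coset
  maxima. By Abel summation a residue is \<open>K\<close> plus a positive combination of the prefix sums of its
  word, hence monotone in the prefix sums. By the cycle lemma every word has a rotation whose prefix
  sums are at least \<open>\<lceil>j (q - 1) / m\<rceil>\<close>. The balanced word attains these values and dominates
  all its rotations, so it gives the smallest coset maximum; its period is \<open>m / gcd(m, q - 1)\<close>.
  For the runner-up, move one unit of the balanced word one place to the left. If \<open>gcd(m, q - 1) > 1\<close>
  and the unit is the first one of the second period, the result is exactly the second smallest
  maximum, and it is primitive. If the gcd is 1, an imprimitive word has \<open>K \<ge> 2\<close>, and then its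
  maximum exceeds that of the modified word; so again the second smallest maximum has full period.

  The generator polynomial is the polynomial over the small field whose roots are the \<open>\<beta>\<^sup>j\<close>
  with \<open>j\<close> outside the cosets of these leaders and of 0, and the minimum distance is the BCH bound.
\<close>

section \<open>The two largest coset leaders\<close>

text \<open>Abel summation in disguise: the number whose base-\<open>q\<close> digits are the
  \<open>m\<close> increments of \<open>F\<close> from \<open>c\<close> on equals
  \<open>F (c + m) - F c\<close> plus \<open>q - 1\<close> times this sum.\<close>

definition window_sum :: "nat \<Rightarrow> nat \<Rightarrow> (nat \<Rightarrow> int) \<Rightarrow> nat \<Rightarrow> int" where
  "window_sum q m F c = (\<Sum>j=1..<m. (F (c + j) - F c) * int q ^ (m - 1 - j))"

text \<open>Multiplying by \<open>q\<close> raises every exponent by one and makes room for a term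
  at \<open>j = m\<close>. Moving the base point from \<open>c\<close> to \<open>Suc c\<close>
  subtracts the first increment from each of the \<open>m\<close> terms, whose weights add up to
  \<open>n\<close>.\<close>

lemma window_sum_Suc:
  assumes "m > 0" and n: "int n = (\<Sum>i<m. int q ^ i)"
  shows "int q * window_sum q m F c + (F (c + m) - F c)
    = int n * (F (Suc c) - F c) + window_sum q m F (Suc c)"
proof -
  define D where "D j = F (c + j) - F c" for j
  define S where "S = (\<Sum>j=1..m. D j * int q ^ (m - j))"
  have "int q * window_sum q m F c = (\<Sum>j=1..<m. D j * int q ^ (m - j))"
    unfolding window_sum_def sum_distrib_left
  proof (intro sum.cong refl)
    fix j assume "j \<in> {1..<m}"
    hence "m - j = Suc (m - 1 - j)" by auto
    thus "int q * ((F (c + j) - F c) * int q ^ (m - 1 - j)) = D j * int q ^ (m - j)"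
      by (simp add: D_def)
  qed
  also have "{1..m} = insert m {1..<m}" using \<open>m > 0\<close> by auto
  hence "(\<Sum>j=1..<m. D j * int q ^ (m - j)) = S - D m"
    unfolding S_def by simp
  finally have 1: "int q * window_sum q m F c = S - D m" .
  have n': "int n = (\<Sum>j=1..m. int q ^ (m - j))"
    unfolding n by (rule sum.reindex_bij_witness[of _ "\<lambda>j. m - j" "\<lambda>i. m - i"]) auto
  have "window_sum q m F (Suc c) = (\<Sum>j=1..<m. (D (Suc j) - D 1) * int q ^ (m - Suc j))"
    unfolding window_sum_def D_def by (intro sum.cong refl) simp
  also have "\<dots> = (\<Sum>j=2..m. (D j - D 1) * int q ^ (m - j))"
    by (rule sum.reindex_bij_witness[of _ "\<lambda>j. j - 1" Suc]) auto
  also have "\<dots> = (\<Sum>j=1..m. (D j - D 1) * int q ^ (m - j))"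
  proof (rule sum.mono_neutral_left)
    show "\<forall>i\<in>{1..m} - {2..m}. (D i - D 1) * int q ^ (m - i) = 0"
    proof
      fix i assume "i \<in> {1..m} - {2..m}"
      hence "i = 1" by auto
      thus "(D i - D 1) * int q ^ (m - i) = 0" by simp
    qed
  qed auto
  also have "\<dots> = S - D 1 * int n"
    unfolding S_def n' by (simp add: left_diff_distrib sum_subtractf sum_distrib_left)
  finally show ?thesis using 1 by (simp add: D_def)
qed

lemma sum_lessThan_periodic:
  fixes f :: "nat \<Rightarrow> int"
  assumes "\<And>i. f (i + m) = f i"
  shows "(\<Sum>i<j + m. f i) = (\<Sum>i<j. f i) + (\<Sum>i<m. f i)"
  by (induction j) (simp_all add: assms)

definition ceil_div :: "nat \<Rightarrow> nat \<Rightarrow> int" where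
  "ceil_div m t = int ((t + (m - 1)) div m)"

text \<open>The Galois connection of the ceiling; almost everything later about
  \<open>ceil_div\<close> and \<open>bal\<close> comes from it and not from the division.\<close>

lemma ceil_div_le_iff:
  assumes "m > 0"
  shows "ceil_div m t \<le> x \<longleftrightarrow> int t \<le> int m * x"
proof (cases "x \<ge> 0")
  case True
  then obtain y where y: "x = int y" using nonneg_int_cases by blast
  have "(t + (m - 1)) div m \<le> y \<longleftrightarrow> (t + (m - 1)) div m < Suc y" by auto
  also have "\<dots> \<longleftrightarrow> t + (m - 1) < Suc y * m"
    using assms by (subst div_less_iff_less_mult) auto
  also have "\<dots> \<longleftrightarrow> t \<le> m * y" using assms by (auto simp: mult.commute)
  also have "\<dots> \<longleftrightarrow> int t \<le> int m * int y"
    by (metis of_nat_le_iff of_nat_mult)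
  finally show ?thesis by (simp add: ceil_div_def y)
next
  case False
  have "int m * x < 0" using False assms by (simp add: mult_pos_neg)
  thus ?thesis using False by (auto simp: ceil_div_def)
qed

lemma less_ceil_div_iff:
  assumes "m > 0"
  shows "x < ceil_div m t \<longleftrightarrow> int m * x < int t"
  using ceil_div_le_iff[OF assms, of t x] by auto

lemma rev_sorted_list_of_set_top_two:
  fixes x y :: nat
  assumes "finite L" "x \<in> L" "y \<in> L" "y < x" "\<And>z. z \<in> L \<Longrightarrow> z = x \<or> z = y \<or> z < y"
  shows "rev (sorted_list_of_set L) ! 0 = x \<and> rev (sorted_list_of_set L) ! 1 = y"
proof -
  define xs where "xs = sorted_list_of_set (L - {x, y})"
  have xs: "set xs = L - {x, y}" "sorted xs" "distinct xs" using assms(1) by (simp_all add: xs_def)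
  have "xs @ [y, x] = sorted_list_of_set L"
  proof (rule sorted_distinct_set_unique)
    show "sorted (xs @ [y, x])" using xs assms(4,5) by (force simp: sorted_append)
    show "distinct (xs @ [y, x])" using xs assms(4) by auto
    show "set (xs @ [y, x]) = set (sorted_list_of_set L)" using xs assms(1-3) by auto
  qed (use assms(1) in auto)
  hence "rev (sorted_list_of_set L) = x # y # rev xs"
    by (metis append_Cons append_Nil rev.simps(2) rev_append rev_rev_ident)
  thus ?thesis by simp
qed

section \<open>Residues modulo the repunit and their cyclotomic cosets\<close>

locale repunit =
  fixes q m n p :: nat
  assumes q: "q > 3" and mq: "m \<ge> q" and n_def: "n = (q ^ m - 1) div (q - 1)"
    and p_def: "p = q - 1"
begin

lemma p_pos: "p \<ge> 3"
  and pm: "p < m" and m_pos: "m > 0" and q_eq: "q = Suc p" and m2: "m \<ge> 2"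
  using q mq by (auto simp: p_def)

lemma p_repunit: "p * (\<Sum>i<m. q ^ i) = q ^ m - 1"
proof -
  have "int (p * (\<Sum>i<m. q ^ i)) = (int q - 1) * (\<Sum>i<m. int q ^ i)"
    using q by (simp add: p_def of_nat_diff)
  also have "\<dots> = int q ^ m - 1" by (rule power_diff_1_eq[symmetric])
  also have "\<dots> = int (q ^ m - 1)" using q by (simp add: of_nat_diff)
  finally show ?thesis by linarith
qed

lemma n_sum_nat: "n = (\<Sum>i<m. q ^ i)"
proof -
  have "n = p * (\<Sum>i<m. q ^ i) div p" unfolding p_repunit by (simp only: n_def p_def)
  also have "\<dots> = (\<Sum>i<m. q ^ i)" using p_pos by (intro nonzero_mult_div_cancel_left) simp
  finally show ?thesis .
qed

lemma n_sum: "int n = (\<Sum>i<m. int q ^ i)"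
  by (simp add: n_sum_nat)

lemma p_n: "p * n = q ^ m - 1"
  by (simp only: n_sum_nat p_repunit)

lemma q_pow_m: "q ^ m = p * n + 1"
  using p_n q by simp

lemma n_gt: "n > m"
proof -
  have "(\<Sum>i<m. 1) < (\<Sum>i<m. q ^ i)"
    using m2 q by (intro sum_strict_mono_ex1) (auto intro!: bexI[of _ 1])
  thus ?thesis by (simp add: n_sum_nat)
qed

lemma coprime_q_n: "coprime q n"
proof -
  have "coprime (q ^ m) n"
    unfolding q_pow_m by (metis coprime_add_one_left coprime_commute coprime_mult_left_iff)
  thus ?thesis using m_pos by simp
qed

abbreviation shift :: "nat \<Rightarrow> nat \<Rightarrow> nat" where
  "shift s c \<equiv> s * q ^ c mod n"

lemma shift_add: "shift (shift s c) d = shift s (c + d)"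
  by (simp add: power_add mod_mult_left_eq mult.assoc)

lemma shift_periodic: "shift s (c + m) = shift s c"
proof -
  have "shift s (c + m) = (s * q ^ c + n * (s * q ^ c * p)) mod n"
    by (simp add: power_add q_pow_m algebra_simps)
  thus ?thesis by simp
qed

lemma shift_mod: "shift s (c mod m) = shift s c"
proof -
  have "s * q ^ (r + k * m) mod n = shift s r" for r k
  proof (induction k)
    case (Suc k)
    have "s * q ^ (r + Suc k * m) mod n = s * q ^ ((r + k * m) + m) mod n" by (simp add: add_ac)
    thus ?case by (simp only: shift_periodic Suc)
  qed simp
  from this[of "c mod m" "c div m"] show ?thesis by simp
qed

lemma shift_less: "shift s c < n"
  using n_gt by simp

lemma shift_pos: assumes "0 < s" "s < n" shows "0 < shift s c"
proof (rule ccontr)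
  assume "\<not> ?thesis"
  hence "n dvd s * q ^ c" by auto
  hence "n dvd s" using coprime_q_n by (simp add: coprime_dvd_mult_left_iff coprime_commute)
  thus False using assms by (auto dest: dvd_imp_le)
qed

lemma shift_cancel:
  assumes "shift s i = shift t i" "s < n" "t < n" shows "s = t"
proof -
  have "[s * q ^ i = t * q ^ i] (mod n)" using assms by (simp add: cong_def)
  hence "[s = t] (mod n)"
    using coprime_q_n by (subst (asm) cong_mult_rcancel_nat) (auto simp: coprime_commute)
  thus ?thesis using assms by (simp add: cong_def)
qed

lemma mem_coset_iff: "x \<in> cyclotomic_coset q m n s \<longleftrightarrow> (\<exists>c. x = shift s c)"
proof
  assume "\<exists>c. x = shift s c"
  then obtain c where "x = shift s (c mod m)" using shift_mod by metis
  thus "x \<in> cyclotomic_coset q m n s" unfolding cyclotomic_coset_def using m_pos by auto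
qed (auto simp: cyclotomic_coset_def)

lemma coset_eq: "cyclotomic_coset q m n s = range (shift s)"
  by (auto simp: mem_coset_iff)

lemma self_mem_coset: "s < n \<Longrightarrow> s \<in> cyclotomic_coset q m n s"
  unfolding mem_coset_iff by (rule exI[of _ 0]) simp

lemma mem_coset_sym:
  assumes "x \<in> cyclotomic_coset q m n s" "s < n"
  shows "s \<in> cyclotomic_coset q m n x"
proof -
  from assms obtain c where c: "c < m" "x = shift s c" by (auto simp: cyclotomic_coset_def)
  have "shift x (m - c) = s"
    unfolding c(2) shift_add using c(1) shift_periodic[of s 0] assms by simp
  thus ?thesis unfolding mem_coset_iff by blast
qed

lemma mem_coset_trans:
  assumes "x \<in> cyclotomic_coset q m n y" "y \<in> cyclotomic_coset q m n z"
  shows "x \<in> cyclotomic_coset q m n z"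
  using assms unfolding mem_coset_iff by (metis shift_add)

text \<open>Multiplication by \<open>q\<close> is invertible modulo \<open>n\<close>, so two equal
  entries of the orbit at positions \<open>i < j\<close> cancel to a return to \<open>s\<close>
  after \<open>j - i\<close> steps.\<close>

lemma card_coset:
  assumes "s < n" "M > 0" "M dvd m" and per: "shift s M = s"
    and min: "\<And>c. 0 < c \<Longrightarrow> c < M \<Longrightarrow> shift s c \<noteq> s"
  shows "card (cyclotomic_coset q m n s) = M"
proof -
  have shM: "shift s (c + k * M) = shift s c" for c k
  proof (induction k)
    case (Suc k)
    have "shift s (c + Suc k * M) = shift (shift s M) (c + k * M)"
      by (simp only: shift_add) (simp add: add_ac)
    thus ?case by (simp only: per Suc)
  qed simp
  have "cyclotomic_coset q m n s = shift s ` {..<M}"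
  proof (intro equalityI subsetI)
    fix x assume "x \<in> cyclotomic_coset q m n s"
    then obtain c where "x = shift s c" by (auto simp: mem_coset_iff)
    hence "x = shift s (c mod M)" using shM[of "c mod M" "c div M"] by simp
    thus "x \<in> shift s ` {..<M}" using \<open>M > 0\<close> by auto
  qed (auto simp: mem_coset_iff)
  moreover have "inj_on (shift s) {..<M}"
  proof (rule linorder_inj_onI)
    fix i j assume ij: "i < j" "i \<in> {..<M}" "j \<in> {..<M}"
    show "shift s i \<noteq> shift s j"
    proof
      assume "shift s i = shift s j"
      also have "shift s j = shift (shift s (j - i)) i" using ij by (simp only: shift_add) simp
      finally have "s = shift s (j - i)"
        using shift_cancel[of s i "shift s (j - i)"] assms(1) shift_less by blast
      thus False using min[of "j - i"] ij
        by (metis diff_less_mono2 lessThan_iff less_imp_diff_less zero_less_diff)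
    qed
  qed auto
  ultimately show ?thesis by (simp add: card_image)
qed

section \<open>Words as prefix sums and the residues they represent\<close>

text \<open>\<open>F\<close> is meant as the prefix sums of a word of period \<open>m\<close> whose
  digits over one period add up to \<open>(q - 1) * K\<close>. Since \<open>F\<close> lives on all
  naturals, a rotation is only another starting point.\<close>

definition quasi_periodic :: "int \<Rightarrow> (nat \<Rightarrow> int) \<Rightarrow> bool" where
  "quasi_periodic K F \<longleftrightarrow> (\<forall>j. F (j + m) = F j + int p * K)"

text \<open>
  By Abel summation, \<open>(q - 1) * val K F c\<close> is the number whose \<open>m\<close> base-\<open>q\<close> digits are the increments
  of \<open>F\<close> starting at \<open>c\<close>.
\<close>

definition val :: "int \<Rightarrow> (nat \<Rightarrow> int) \<Rightarrow> nat \<Rightarrow> int" where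
  "val K F c = K + window_sum q m F c"

lemma int_q: "int q = int p + 1"
  by (simp add: q_eq)

lemma quasi_periodicD: "quasi_periodic K F \<Longrightarrow> F (j + m) = F j + int p * K"
  by (simp add: quasi_periodic_def)

text \<open>Rotating the word by one place is multiplication by \<open>q\<close> modulo
  \<open>n\<close>; the multiple of \<open>n\<close> that splits off is the first digit of the
  window.\<close>

lemma val_Suc:
  assumes "quasi_periodic K F"
  shows "int q * val K F c = int n * (F (Suc c) - F c) + val K F (Suc c)"
  using window_sum_Suc[OF m_pos n_sum, of F c] quasi_periodicD[OF assms, of c]
  by (simp add: val_def int_q algebra_simps)

lemma val_periodic:
  assumes "quasi_periodic K F"
  shows "val K F (c + m) = val K F c"
proof -
  have "F (c + m + j) - F (c + m) = F (c + j) - F c" for j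
    using quasi_periodicD[OF assms, of "c + j"] quasi_periodicD[OF assms, of c]
      by (simp add: add_ac)
  thus ?thesis by (simp add: val_def window_sum_def)
qed

text \<open>By \<open>val_Suc\<close> consecutive values agree modulo \<open>n\<close> up to the
  factor \<open>q\<close>, and the range hypothesis makes each value the reduced
  representative.\<close>

lemma val_shift:
  assumes F: "quasi_periodic K F" and "\<And>c. 0 \<le> val K F c \<and> val K F c < int n"
  shows "val K F c = int (shift (nat (val K F 0)) c)"
proof (induction c)
  case 0
  show ?case using assms(2)[of 0] by (simp add: nat_less_iff)
next
  case (Suc c)
  let ?s = "nat (val K F 0)"
  have "val K F (Suc c) = val K F (Suc c) mod int n" using assms(2) by simp
  also have "\<dots> = (int q * val K F c) mod int n" by (simp add: val_Suc[OF F])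
  also have "\<dots> = (int q * int (?s * q ^ c)) mod int n"
    by (simp add: Suc zmod_int mod_mult_right_eq)
  also have "\<dots> = int (shift ?s (Suc c))" by (simp add: zmod_int mult_ac)
  finally show ?case .
qed

lemma val_mono:
  assumes "K \<le> K'" "\<And>j. 0 < j \<Longrightarrow> j < m \<Longrightarrow> F (c + j) - F c \<le> F' (c' + j) - F' c'"
  shows "val K F c \<le> val K' F' c'"
  unfolding val_def window_sum_def using assms
  by (intro add_mono sum_mono mult_right_mono) auto

text \<open>Prefix sums are integers, so a strict inequality at \<open>i\<close> gains at least the
  whole weight of that position.\<close>

lemma val_mono_strict:
  assumes "K \<le> K'" "\<And>j. 0 < j \<Longrightarrow> j < m \<Longrightarrow> F (c + j) - F c \<le> F' (c' + j) - F' c'"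
    and i: "0 < i" "i < m" and "F (c + i) - F c < F' (c' + i) - F' c'"
  shows "val K F c + int q ^ (m - 1 - i) \<le> val K' F' c'"
proof -
  have "window_sum q m F c + int q ^ (m - 1 - i)
    = (\<Sum>j=1..<m. (F (c + j) - F c) * int q ^ (m - 1 - j) + (if j = i then int q ^ (m - 1 - j) else 0))"
    using i by (simp add: window_sum_def sum.distrib)
  also have "\<dots> = (\<Sum>j=1..<m. (F (c + j) - F c + (if j = i then 1 else 0)) * int q ^ (m - 1 - j))"
    by (intro sum.cong) (auto simp: algebra_simps)
  also have "\<dots> \<le> window_sum q m F' c'"
    unfolding window_sum_def using assms(2,5)
    by (intro sum_mono mult_right_mono) (auto simp: add_ac)
  finally show ?thesis using assms(1) by (simp add: val_def)
qed

lemma mono_of_steps: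
  fixes F :: "nat \<Rightarrow> int"
  assumes "\<And>j. F j \<le> F (Suc j)" shows "F c \<le> F (c + j)"
  by (induction j) (auto intro: order_trans[OF _ assms])

lemma val_bounds:
  assumes F: "quasi_periodic K F" and "K \<ge> 1"
    and steps: "\<And>j. F j \<le> F (Suc j)" "\<And>j. F (Suc j) \<le> F j + 2"
  shows "0 < val K F c \<and> val K F c < int n"
proof -
  have pos: "0 < val K F c" for c
  proof -
    have "0 \<le> window_sum q m F c"
      unfolding window_sum_def using mono_of_steps[of F] steps by (intro sum_nonneg) auto
    thus ?thesis using \<open>K \<ge> 1\<close> by (simp add: val_def)
  qed
  define A where "A = Max (val K F ` {..<m})"
  have le: "val K F c \<le> A" for c
  proof -
    have "val K F (r + k * m) = val K F r" for r k
    proof (induction k)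
      case (Suc k)
      have "val K F (r + Suc k * m) = val K F ((r + k * m) + m)" by (simp add: add_ac)
      thus ?case by (simp only: val_periodic[OF F] Suc)
    qed simp
    from this[of "c mod m" "c div m"] have "val K F c = val K F (c mod m)" by simp
    thus ?thesis unfolding A_def using m_pos by (auto intro!: Max_ge)
  qed
  have "A \<in> val K F ` {..<m}" unfolding A_def using m_pos by (intro Max_in) auto
  then obtain c0 where c0: "A = val K F c0" by auto
  have "int q * A \<le> int n * 2 + A"
    unfolding c0 val_Suc[OF F] using le[of "Suc c0"] steps(2)[of c0]
    by (intro add_mono mult_left_mono) (auto simp: c0)
  hence "int p * A \<le> int n * 2" by (simp add: int_q algebra_simps)
  also have "\<dots> < int n * int p" using p_pos n_gt by (intro mult_strict_left_mono) auto
  finally have "A < int n"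
    by (metis mult.commute mult_less_cancel_left_pos of_nat_0_less_iff p_pos less_le_trans zero_less_numeral)
  thus ?thesis using pos[of c] le[of c] by auto
qed

text \<open>Prefix sums of the base-\<open>q\<close> expansion of \<open>s / n\<close>, which has period \<open>m\<close>.\<close>

definition digit_sums :: "nat \<Rightarrow> nat \<Rightarrow> int" where
  "digit_sums s j = (\<Sum>i<j. int q * int (shift s i) div int n)"

lemma digit_sums_add:
  assumes "shift s d = s"
  shows "digit_sums s (j + d) = digit_sums s j + digit_sums s d"
  unfolding digit_sums_def
proof (rule sum_lessThan_periodic)
  fix i
  have "shift s (i + d) = shift (shift s d) i" by (simp only: shift_add add.commute)
  thus "int q * int (shift s (i + d)) div int n = int q * int (shift s i) div int n"
    by (simp only: assms)
qed

lemma digit_sums_step: "digit_sums s j \<le> digit_sums s (Suc j)"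
  unfolding digit_sums_def by (simp flip: of_nat_mult zdiv_int)

lemma digit_sums_0 [simp]: "digit_sums s 0 = 0"
  by (simp add: digit_sums_def)

lemma digit_sums_Suc: "int n * (digit_sums s (Suc c) - digit_sums s c) = int q * int (shift s c) - int (shift s (Suc c))"
proof -
  have "int (shift s (Suc c)) = int q * int (shift s c) mod int n"
    by (simp add: zmod_int mod_mult_right_eq mult_ac)
  thus ?thesis by (simp add: digit_sums_def minus_mod_eq_mult_div)
qed

text \<open>The values computed from the digits and the residues themselves obey the same recursion,
  so their discrepancy is multiplied by \<open>q\<close> at each step. Being periodic as well, it
  vanishes.\<close>

lemma digit_sums_val:
  assumes s: "0 < s" "s < n"
  obtains K where "K \<ge> 1" "quasi_periodic K (digit_sums s)" "\<And>c. val K (digit_sums s) c = int (shift s c)"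
proof -
  define F where "F = digit_sums s"
  define L where "L = F m"
  have FL: "F (c + m) = F c + L" for c
    unfolding L_def F_def using shift_periodic[of s 0] s by (intro digit_sums_add) simp
  \<comment> \<open>The discrepancy, scaled by \<open>p\<close> because it is not yet known that the
    digit sum \<open>L\<close> of one period is a multiple of \<open>p\<close>.\<close>
  define z where "z c = int p * int (shift s c) - (L + int p * window_sum q m F c)" for c
  have zS: "z (Suc c) = int q * z c" for c
  proof -
    have "int q * window_sum q m F c + L = int n * (F (Suc c) - F c) + window_sum q m F (Suc c)"
      using window_sum_Suc[OF m_pos n_sum, of F c] by (simp add: FL)
    hence "int p * window_sum q m F (Suc c) = int p * (int q * window_sum q m F c + L - int n * (F (Suc c) - F c))"
      by simp
    moreover have "int p * (int n * (F (Suc c) - F c)) = int p * (int q * int (shift s c) - int (shift s (Suc c)))"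
      by (simp only: F_def digit_sums_Suc)
    ultimately have "int p * window_sum q m F (Suc c) = int p * (int q * window_sum q m F c + L)
        - int p * (int q * int (shift s c) - int (shift s (Suc c)))"
      by (simp only: right_diff_distrib)
    thus ?thesis unfolding z_def by (simp only: int_q) (simp add: algebra_simps)
  qed
  have "z c = int q ^ c * z 0" for c by (induction c) (simp_all add: zS)
  note zp = this
  have "z m = z 0"
  proof -
    have "F (m + j) - F m = F (0 + j) - F 0" for j using FL[of j] FL[of 0] by (simp add: add_ac)
    hence "window_sum q m F m = window_sum q m F 0" by (simp add: window_sum_def)
    thus ?thesis using shift_periodic[of s 0] by (simp add: z_def)
  qed
  hence "(int q ^ m - 1) * z 0 = 0" using zp[of m] by (simp add: algebra_simps)
  moreover have "int q ^ m > 1" using q m_pos by (intro one_less_power) auto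
  ultimately have "z 0 = 0" by auto
  hence key: "int p * int (shift s c) = L + int p * window_sum q m F c" for c
    using zp[of c] by (simp add: z_def)
  from key[of 0] have "L = int p * (int (shift s 0) - window_sum q m F 0)"
    by (simp only: right_diff_distrib)
  then obtain K where K: "L = int p * K" by blast
  have v: "val K F c = int (shift s c)" for c
  proof -
    have "int p * int (shift s c) = int p * val K F c"
      using key[of c] by (simp add: K val_def algebra_simps)
    thus ?thesis using p_pos by simp
  qed
  \<comment> \<open>With a digit sum at most 0 the nondecreasing prefix sums vanish on the window,
    and the residue would not be positive.\<close>
  have "K \<ge> 1"
  proof (rule ccontr)
    assume "\<not> K \<ge> 1"
    hence "L \<le> 0" unfolding K by (simp add: mult_nonneg_nonpos)
    have mono: "F i \<le> F (i + j)" for i j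
      unfolding F_def by (rule mono_of_steps) (rule digit_sums_step)
    have "F j = 0" if "j < m" for j
      using mono[of 0 j] mono[of j "m - j"] that \<open>L \<le> 0\<close> by (simp add: L_def F_def)
    hence "window_sum q m F 0 = 0" by (simp add: window_sum_def F_def)
    hence "val K F 0 \<le> 0" using \<open>\<not> K \<ge> 1\<close> by (simp add: val_def)
    thus False using v[of 0] s by simp
  qed
  thus ?thesis using that[of K] FL v by (simp add: quasi_periodic_def F_def K)
qed

text \<open>The deviation \<open>\<phi>\<close> of \<open>m * F\<close> from its mean slope has
  period \<open>m\<close>; a starting point that minimises it works for every \<open>j\<close> at
  once.\<close>

lemma cycle_lemma:
  assumes F: "quasi_periodic K F"
  obtains c where "\<And>j. int (j * p) * K \<le> int m * (F (c + j) - F c)"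
proof -
  define \<phi> where "\<phi> c = int m * F c - int (c * p) * K" for c
  have per: "\<phi> (c + m) = \<phi> c" for c
    using quasi_periodicD[OF F, of c] by (simp add: \<phi>_def algebra_simps)
  define A where "A = Min (\<phi> ` {..<m})"
  have "A \<in> \<phi> ` {..<m}" unfolding A_def using m_pos by (intro Min_in) auto
  then obtain c where c: "A = \<phi> c" by auto
  have le: "A \<le> \<phi> i" for i
  proof -
    have "\<phi> (r + k * m) = \<phi> r" for r k
    proof (induction k)
      case (Suc k)
      have "\<phi> (r + Suc k * m) = \<phi> ((r + k * m) + m)" by (simp add: add_ac)
      thus ?case by (simp only: per Suc)
    qed simp
    from this[of "i mod m" "i div m"] have "\<phi> i = \<phi> (i mod m)" by simp
    thus ?thesis unfolding A_def using m_pos by (auto intro!: Min_le)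
  qed
  show ?thesis
  proof (rule that[of c])
    fix j show "int (j * p) * K \<le> int m * (F (c + j) - F c)"
      using le[of "c + j"] unfolding c by (simp add: \<phi>_def algebra_simps)
  qed
qed

section \<open>The balanced word\<close>

text \<open>Prefix sums of the upper mechanical word of slope \<open>p / m\<close>, whose digits are
  0 and 1 because \<open>p < m\<close>.\<close>

definition bal :: "nat \<Rightarrow> int" where
  "bal j = ceil_div m (j * p)"

lemma bal_le_iff: "bal j \<le> x \<longleftrightarrow> int (j * p) \<le> int m * x"
  unfolding bal_def by (rule ceil_div_le_iff[OF m_pos])

lemma bal_ge: "int (j * p) \<le> int m * bal j"
  using bal_le_iff[of j "bal j"] by simp

text \<open>Ceilings are subadditive. This is why the starting point 0 dominates all other rotations
  of the balanced word.\<close>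

lemma bal_subadd: "bal (c + j) \<le> bal c + bal j"
  using bal_ge[of c] bal_ge[of j] by (simp add: bal_le_iff algebra_simps)

lemma bal_0 [simp]: "bal 0 = 0"
  using m_pos by (simp add: bal_def ceil_div_def)

lemma bal_step: "bal j \<le> bal (Suc j)"
proof -
  have "int (j * p) \<le> int (Suc j * p)" by simp
  also have "\<dots> \<le> int m * bal (Suc j)" by (rule bal_ge)
  finally show ?thesis by (simp add: bal_le_iff)
qed

lemma bal_Suc_le: "bal (Suc j) \<le> bal j + 1"
  using bal_ge[of j] pm by (simp add: bal_le_iff algebra_simps)

text \<open>Here \<open>bal_period\<close> and \<open>bal_weight\<close> are variables: any pair
  with the ratio of \<open>m\<close> to \<open>p\<close> will do, since the argument of the ceiling
  then moves by an integer. It is used both for \<open>m\<close> and \<open>p\<close> and for the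
  reduced pair defined below.\<close>

lemma bal_add_period:
  assumes "bal_period * p = m * bal_weight"
  shows "bal (j + k * bal_period) = bal j + int (k * bal_weight)"
proof (rule antisym)
  have eq: "int ((j + k * bal_period) * p) = int (j * p) + int m * int (k * bal_weight)"
    using assms by (metis distrib_right mult.assoc mult.left_commute of_nat_add of_nat_mult)
  show "bal (j + k * bal_period) \<le> bal j + int (k * bal_weight)"
    unfolding bal_le_iff eq using bal_ge[of j] by (simp add: distrib_left)
  have "bal j \<le> bal (j + k * bal_period) - int (k * bal_weight)"
    unfolding bal_le_iff
      using bal_ge[of "j + k * bal_period"] unfolding eq by (simp add: right_diff_distrib)
  thus "bal j + int (k * bal_weight) \<le> bal (j + k * bal_period)" by simp
qed

lemma quasi_periodic_bal: "quasi_periodic 1 bal"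
  using bal_add_period[of m p _ 1] by (simp add: quasi_periodic_def)

text \<open>The fraction \<open>m / p\<close> in lowest terms: the least period of the balanced word
  and the number of units in one such period.\<close>

definition bal_period :: nat where "bal_period = m div gcd m p"
definition bal_weight :: nat where "bal_weight = p div gcd m p"

lemma bal_period_weight: "bal_period * p = m * bal_weight" and bal_period_pos: "bal_period > 0"
  and bal_period_dvd: "bal_period dvd m"
    and coprime_bal_period_weight: "coprime bal_period bal_weight"
  and bal_period_le: "bal_period \<le> m"
proof -
  show "bal_period * p = m * bal_weight"
    unfolding bal_period_def bal_weight_def by (metis div_mult_swap dvd_div_mult gcd_dvd1 gcd_dvd2)
  show "bal_period > 0" unfolding bal_period_def
    by (metis div_greater_zero_iff gcd_le1_nat gcd_pos_nat less_irrefl m_pos)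
  show "bal_period dvd m"
    unfolding bal_period_def by (metis dvd_div_mult_self dvd_triv_left gcd_dvd1)
  show "coprime bal_period bal_weight"
    unfolding bal_period_def bal_weight_def using m_pos by (intro div_gcd_coprime) auto
  show "bal_period \<le> m" unfolding bal_period_def by simp
qed

lemma bal_period_mult: "m = gcd m p * bal_period"
  unfolding bal_period_def by simp

text \<open>The ceiling is exact at the multiples of \<open>bal_period\<close> and nowhere else.
  With an exact value at \<open>c + j\<close> and a rounded-up one at \<open>c\<close>,
  subadditivity is strict.\<close>

lemma bal_less:
  assumes "\<not> bal_period dvd c" "bal_period dvd c + j"
  shows "bal (c + j) - bal c < bal j"
proof (rule ccontr)
  assume "\<not> ?thesis"
  hence "bal j \<le> bal (c + j) - bal c" by simp
  hence *: "int (j * p) \<le> int m * bal (c + j) - int m * bal c"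
    by (simp add: bal_le_iff right_diff_distrib)
  obtain k where k: "c + j = k * bal_period" using assms(2) by (metis dvd_def mult.commute)
  have "int m * bal (c + j) = int ((c + j) * p)"
    unfolding k using bal_add_period[OF bal_period_weight, of 0 k] bal_period_weight
      by (simp add: mult.assoc mult.left_commute flip: of_nat_mult)
  with * have "int m * bal c \<le> int (c * p)" by (simp add: algebra_simps)
  with bal_ge[of c] have "int m * bal c = int (c * p)" by simp
  hence "int m dvd int (c * p)" by (metis dvd_triv_left)
  hence "m dvd c * p" by (simp only: of_nat_dvd_iff)
  hence "gcd m p * bal_period dvd gcd m p * (c * bal_weight)"
    unfolding bal_period_def bal_weight_def by (simp add: mult.left_commute)
  hence "bal_period dvd c * bal_weight" using m_pos by simp
  hence "bal_period dvd c" using coprime_bal_period_weight by (simp add: coprime_dvd_mult_left_iff)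
  thus False using assms by simp
qed

definition bal_val :: int where "bal_val = val 1 bal 0"

lemma val_bal_le: "val 1 bal c \<le> bal_val"
  unfolding bal_val_def
    by (rule val_mono) (use bal_subadd in \<open>auto simp: algebra_simps\<close>)

lemma val_bal_eq_iff: "val 1 bal c = bal_val \<longleftrightarrow> bal_period dvd c"
proof
  assume "bal_period dvd c"
  then obtain k where k: "c = k * bal_period" by (metis dvd_def mult.commute)
  have "bal (c + j) - bal c = bal j" for j
    using bal_add_period[OF bal_period_weight, of j k] bal_add_period[OF bal_period_weight, of 0 k]
      by (simp add: k add.commute)
  thus "val 1 bal c = bal_val" by (simp add: bal_val_def val_def window_sum_def)
next
  assume eq: "val 1 bal c = bal_val"
  show "bal_period dvd c"
  proof (rule ccontr)
    assume nd: "\<not> bal_period dvd c"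
    \<comment> \<open>The distance from \<open>c\<close> to the next multiple of
      \<open>bal_period\<close>, where \<open>bal_less\<close> supplies a strict inequality.\<close>
    define i where "i = bal_period - c mod bal_period"
    have "0 < c mod bal_period" "c mod bal_period < bal_period"
      using nd bal_period_pos by (auto simp: mod_greater_zero_iff_not_dvd)
    hence i: "0 < i" "i < m" using bal_period_le unfolding i_def by linarith+
    have "c + i = c div bal_period * bal_period + bal_period"
      unfolding i_def
        using div_mult_mod_eq[of c bal_period] \<open>c mod bal_period < bal_period\<close>
          by linarith
    hence "bal_period dvd c + i" by simp
    hence "val 1 bal c + int q ^ (m - 1 - i) \<le> val 1 bal 0"
      using i bal_less[OF nd, of i] bal_subadd[of c]
        by (intro val_mono_strict) (auto simp: algebra_simps)
    moreover have "0 < int q ^ (m - 1 - i)" using q by simp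
    ultimately show False using eq unfolding bal_val_def by linarith
  qed
qed

lemma val_bal_bounds: "0 < val 1 bal c \<and> val 1 bal c < int n"
proof (rule val_bounds[OF quasi_periodic_bal])
  show "bal j \<le> bal (Suc j)" "bal (Suc j) \<le> bal j + 2" for j
    using bal_step[of j] bal_Suc_le[of j] by auto
qed simp

definition bal_residue :: nat where "bal_residue = nat bal_val"

lemma bal_residue_pos: "0 < bal_residue"
  and bal_residue_less: "bal_residue < n" and int_bal_residue: "int bal_residue = bal_val"
  using val_bal_bounds[of 0] by (auto simp: bal_residue_def bal_val_def)

lemma shift_bal_residue: "int (shift bal_residue c) = val 1 bal c"
  using val_shift[OF quasi_periodic_bal, of c] val_bal_bounds
    by (simp add: bal_residue_def bal_val_def less_imp_le)

lemma shift_bal_residue_le: "shift bal_residue c \<le> bal_residue"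
  using val_bal_le[of c] shift_bal_residue[of c] int_bal_residue by linarith

lemma card_coset_bal_residue: "card (cyclotomic_coset q m n bal_residue) = bal_period"
proof (rule card_coset[OF bal_residue_less bal_period_pos bal_period_dvd])
  have "int (shift bal_residue bal_period) = int bal_residue"
    unfolding shift_bal_residue int_bal_residue by (simp add: val_bal_eq_iff)
  thus "shift bal_residue bal_period = bal_residue" by (simp only: of_nat_eq_iff)
next
  fix c assume "0 < c" "c < bal_period"
  hence "\<not> bal_period dvd c" by (simp add: nat_dvd_not_less)
  hence "int (shift bal_residue c) \<noteq> int bal_residue"
    unfolding shift_bal_residue int_bal_residue by (simp add: val_bal_eq_iff)
  thus "shift bal_residue c \<noteq> bal_residue" by linarith
qed

text \<open>The last bound is the previous one weakened by \<open>K >= 1\<close> and rounded up. The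
  sharper one is kept for words with \<open>K >= 2\<close>.\<close>

lemma rotation_above:
  assumes "0 < s" "s < n"
  obtains K c where "K \<ge> 1" "quasi_periodic K (digit_sums s)"
    "\<And>c. val K (digit_sums s) c = int (shift s c)"
    "\<And>j. int (j * p) * K \<le> int m * (digit_sums s (c + j) - digit_sums s c)"
    "\<And>j. bal j \<le> digit_sums s (c + j) - digit_sums s c"
proof -
  obtain K where K: "K \<ge> 1" "quasi_periodic K (digit_sums s)" "\<And>c. val K (digit_sums s) c = int (shift s c)"
    using digit_sums_val[OF assms] by blast
  obtain c where c: "\<And>j. int (j * p) * K \<le> int m * (digit_sums s (c + j) - digit_sums s c)"
    using cycle_lemma[OF K(2)] by blast
  have "bal j \<le> digit_sums s (c + j) - digit_sums s c" for j
    unfolding bal_le_iff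
  proof (rule order_trans[OF _ c])
    show "int (j * p) \<le> int (j * p) * K"
      using mult_left_mono[OF K(1), of "int (j * p)"] by simp
  qed
  thus ?thesis using that[OF K c] by blast
qed

lemma shift_greater_bal_residue:
  assumes s: "0 < s" "s < n" and "s \<notin> cyclotomic_coset q m n bal_residue"
  shows "\<exists>c. bal_residue < shift s c"
proof -
  obtain K c where K: "K \<ge> 1" "\<And>c. val K (digit_sums s) c = int (shift s c)"
    "\<And>j. bal j \<le> digit_sums s (c + j) - digit_sums s c"
    using rotation_above[OF s] by metis
  have "bal_val \<le> int (shift s c)"
    unfolding bal_val_def K(2)[symmetric] using K by (intro val_mono) auto
  hence "bal_residue \<le> shift s c" using int_bal_residue by linarith
  moreover have "bal_residue \<noteq> shift s c"
    using assms mem_coset_sym[of bal_residue s] by (auto simp: mem_coset_iff)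
  ultimately show ?thesis by (intro exI[of _ c]) auto
qed

text \<open>The word of \<open>bal\<close> with a unit moved from position \<open>d\<close> one place to the left.\<close>

definition bal_move :: "nat \<Rightarrow> nat \<Rightarrow> int" where
  "bal_move d j = bal j + of_bool (j mod m = d)"

lemma quasi_periodic_bal_move: "quasi_periodic 1 (bal_move d)"
  using quasi_periodic_bal by (simp add: quasi_periodic_def bal_move_def)

lemma val_bal_move_0:
  assumes "0 < d" "d < m"
  shows "val 1 (bal_move d) 0 = bal_val + int q ^ (m - 1 - d)"
proof -
  have "window_sum q m (bal_move d) 0 = (\<Sum>j=1..<m. bal j * int q ^ (m - 1 - j) + (if j = d then int q ^ (m - 1 - j) else 0))"
    unfolding window_sum_def using assms
    by (intro sum.cong) (auto simp: bal_move_def algebra_simps)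
  also have "\<dots> = window_sum q m bal 0 + int q ^ (m - 1 - d)"
    using assms by (simp add: window_sum_def sum.distrib)
  finally show ?thesis by (simp add: val_def bal_val_def)
qed

lemma bal_Suc_mod:
  assumes "bal (Suc d) = bal d + 1" "j mod m = d"
  shows "bal (Suc j) = bal j + 1"
proof -
  have "j = d + j div m * m" using assms by (metis add.commute div_mult_mod_eq)
  thus ?thesis
    using bal_add_period[of m p d "j div m"] bal_add_period[of m p "Suc d" "j div m"] assms(1)
    by (metis add.commute add.left_commute add_Suc mult.commute)
qed

text \<open>The hypothesis says that a unit stands at position \<open>d\<close>; only then do the
  modified prefix sums stay nondecreasing.\<close>

lemma val_bal_move_bounds:
  assumes "bal (Suc d) = bal d + 1"
  shows "0 < val 1 (bal_move d) c \<and> val 1 (bal_move d) c < int n"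
proof (rule val_bounds[OF quasi_periodic_bal_move])
  fix j
  show "bal_move d j \<le> bal_move d (Suc j)"
    using bal_step[of j] bal_Suc_mod[OF assms, of j] by (auto simp: bal_move_def)
  show "bal_move d (Suc j) \<le> bal_move d j + 2"
    using bal_Suc_le[of j] by (auto simp: bal_move_def)
qed simp

lemma shift_bal_move:
  assumes "bal (Suc d) = bal d + 1" "0 < d" "d < m"
  obtains v where "0 < v" "v < n" "v \<notin> cyclotomic_coset q m n bal_residue"
    "\<And>c. int (shift v c) = val 1 (bal_move d) c" "int v = bal_val + int q ^ (m - 1 - d)"
proof -
  define v where "v = nat (val 1 (bal_move d) 0)"
  have v: "0 < v" "v < n" "int v = val 1 (bal_move d) 0"
    using val_bal_move_bounds[OF assms(1), of 0] by (auto simp: v_def)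
  have sh: "int (shift v c) = val 1 (bal_move d) c" for c
    using val_shift[OF quasi_periodic_bal_move, of d c] val_bal_move_bounds[OF assms(1)]
      by (simp add: v_def less_imp_le)
  have "int v = bal_val + int q ^ (m - 1 - d)" using val_bal_move_0 assms v by simp
  moreover have "int q ^ (m - 1 - d) > 0" using q by simp
  ultimately have "v > bal_residue" using int_bal_residue by linarith
  hence "v \<notin> cyclotomic_coset q m n bal_residue"
    using shift_bal_residue_le by (auto simp: mem_coset_iff not_le[symmetric])
  thus ?thesis using that[of v] v sh \<open>int v = bal_val + _\<close> by blast
qed

section \<open>The second smallest coset maximum\<close>

lemma card_coset_full:
  assumes "s < n" "\<And>c. 0 < c \<Longrightarrow> c < m \<Longrightarrow> shift s c \<noteq> s"
  shows "card (cyclotomic_coset q m n s) = m"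
  using assms shift_periodic[of s 0] m_pos by (intro card_coset) auto

text \<open>\<open>n - v\<close> is going to be the second largest leader. The last clause says that
  every further nonzero coset has a larger maximum; the size of the coset is recorded for the
  dimension.\<close>

definition second_max :: "nat \<Rightarrow> bool" where
  "second_max v \<longleftrightarrow> 0 < v \<and> v < n \<and> v \<notin> cyclotomic_coset q m n bal_residue \<and>
    card (cyclotomic_coset q m n v) = m \<and> (\<forall>c. shift v c \<le> v) \<and>
    (\<forall>s. 0 < s \<longrightarrow> s < n \<longrightarrow> s \<notin> cyclotomic_coset q m n bal_residue \<longrightarrow>
      s \<in> cyclotomic_coset q m n v \<or> (\<exists>c. v < shift s c))"

text \<open>Take the rotation above the balanced word and the first prefix sum that exceeds it. Up
  to there the two agree, so the start can be advanced by whole periods of the balanced word until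
  the excess occurs at an index at most \<open>bal_period\<close>, where it weighs at least the
  stated power.\<close>

lemma shift_ge_unbalanced:
  assumes s: "0 < s" "s < n" "s \<notin> cyclotomic_coset q m n bal_residue"
    and Mm: "bal_period < m"
  shows "\<exists>c. bal_val + int q ^ (m - 1 - bal_period) \<le> int (shift s c)"
proof -
  define F where "F = digit_sums s"
  obtain K c where K: "K \<ge> 1" "quasi_periodic K F" "\<And>c. val K F c = int (shift s c)"
    "\<And>j. bal j \<le> F (c + j) - F c"
    using rotation_above[OF s(1,2)] unfolding F_def by metis
  have "\<exists>j. F (c + j) - F c \<noteq> bal j"
  proof (rule ccontr)
    assume "\<not> ?thesis"
    hence eq: "F (c + j) - F c = bal j" for j by auto
    \<comment> \<open>Agreement at \<open>j = m\<close> compares the digit sums and yields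
      \<open>K = 1\<close>.\<close>
    have "int p * K = int p" using eq[of m] quasi_periodicD[OF K(2), of c]
      quasi_periodicD[OF quasi_periodic_bal, of 0] by simp
    hence "K = 1" using p_pos by simp
    hence "int (shift s c) = bal_val"
      unfolding K(3)[symmetric] by (simp add: bal_val_def val_def window_sum_def eq)
    hence "bal_residue = shift s c" using int_bal_residue by linarith
    hence "bal_residue \<in> cyclotomic_coset q m n s" by (auto simp: mem_coset_iff)
    thus False using mem_coset_sym s by blast
  qed
  define j where "j = (LEAST j. F (c + j) - F c \<noteq> bal j)"
  have j: "F (c + j) - F c \<noteq> bal j"
    unfolding j_def by (rule LeastI_ex) fact
  have below_j: "F (c + i) - F c = bal i" if "i < j" for i
    using not_less_Least[of i "\<lambda>j. F (c + j) - F c \<noteq> bal j"] that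
      unfolding j_def by blast
  have "j > 0" using j by (cases j) auto
  \<comment> \<open>Dividing \<open>j - 1\<close> and not \<open>j\<close> puts the remaining index
    \<open>i\<close> into \<open>1..bal_period\<close>; an index 0 would carry no weight.\<close>
  define k where "k = (j - 1) div bal_period"
  define i where "i = j - k * bal_period"
  have kj: "k * bal_period \<le> j - 1" unfolding k_def by (rule div_times_less_eq_dividend)
  have "j - 1 < k * bal_period + bal_period" unfolding k_def using bal_period_pos
    by (metis add.commute div_mult_mod_eq mod_less_divisor nat_add_left_cancel_less)
  hence i: "0 < i" "i \<le> bal_period" "k * bal_period + i = j"
    using kj \<open>j > 0\<close> unfolding i_def by linarith+
  have Fk: "F (c + k * bal_period) - F c = int (k * bal_weight)"
    using below_j[of "k * bal_period"] kj \<open>j > 0\<close> bal_add_period[OF bal_period_weight, of 0 k] by simp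
  have ge: "bal x \<le> F (c + k * bal_period + x) - F (c + k * bal_period)" for x
    using K(4)[of "k * bal_period + x"] bal_add_period[OF bal_period_weight, of x k] Fk
      by (simp add: add_ac)
  have "bal i < F (c + k * bal_period + i) - F (c + k * bal_period)"
    using K(4)[of j] j bal_add_period[OF bal_period_weight, of i k] Fk i(3) by (simp add: add_ac)
  hence "val 1 bal 0 + int q ^ (m - 1 - i) \<le> val K F (c + k * bal_period)"
    using K(1) ge i Mm by (intro val_mono_strict) auto
  moreover have "int q ^ (m - 1 - bal_period) \<le> int q ^ (m - 1 - i)"
    using i q by (intro power_increasing) auto
  ultimately show ?thesis
    unfolding K(3) bal_val_def by (intro exI[of _ "c + k * bal_period"]) linarith
qed

text \<open>\<open>shift_ge_unbalanced\<close> gives a lower bound for the other maxima, and moving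
  the first unit of the second period attains it. What remains is that this word strictly dominates
  its own rotations, which yields both maximality and full period.\<close>

lemma ex_second_max_periodic:
  assumes Mm: "bal_period < m"
  shows "\<exists>v. second_max v"
proof -
  have E_M: "bal (x + bal_period) = bal x + int bal_weight" for x
    using bal_add_period[OF bal_period_weight, of x 1] by simp
  have "bal (Suc 0) > 0" using p_pos unfolding bal_def by (subst less_ceil_div_iff[OF m_pos]) auto
  hence "bal (Suc 0) = 1" using bal_Suc_le[of 0] by simp
  hence E_Suc_M: "bal (Suc bal_period) = bal bal_period + 1" using E_M[of 1] E_M[of 0] by simp
  obtain v where v: "0 < v" "v < n" "v \<notin> cyclotomic_coset q m n bal_residue"
    "\<And>c. int (shift v c) = val 1 (bal_move bal_period) c" "int v = bal_val + int q ^ (m - 1 - bal_period)"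
    using shift_bal_move[OF E_Suc_M bal_period_pos Mm] by metis
  have le_w0: "val 1 (bal_move bal_period) c < int v" if "\<And>j. 0 < j \<Longrightarrow> j < m \<Longrightarrow> bal_move bal_period (c + j) - bal_move bal_period c \<le> bal j" for c
  proof -
    have "val 1 (bal_move bal_period) c \<le> val 1 bal 0" using that by (intro val_mono) auto
    moreover have "int q ^ (m - 1 - bal_period) > 0" using q by simp
    ultimately show ?thesis unfolding v(5) bal_val_def by linarith
  qed
  have strict: "shift v c < v" if c: "0 < c" "c < m" for c
  proof -
    have "val 1 (bal_move bal_period) c < int v"
    proof (cases "bal_period dvd c")
      case False
      show ?thesis
      proof (rule le_w0)
        fix j assume j: "0 < j" "j < m"
        show "bal_move bal_period (c + j) - bal_move bal_period c \<le> bal j"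
        \<comment> \<open>The added unit is felt only where \<open>c + j\<close> is a multiple of
          \<open>bal_period\<close>, and there \<open>bal_less\<close> leaves room for it.\<close>
        proof (cases "(c + j) mod m = bal_period")
          case True
          hence "bal_period dvd (c + j) mod m" by simp
          hence "bal_period dvd c + j" using bal_period_dvd by (simp add: dvd_mod_iff)
          from bal_less[OF False this] show ?thesis by (simp add: bal_move_def)
        qed (use bal_subadd[of c j] in \<open>simp add: bal_move_def\<close>)
      qed
    next
      case dvd: True
      show ?thesis
      proof (cases "c = bal_period")
        case True
        show ?thesis
        proof (rule le_w0)
          \<comment> \<open>The raised prefix sum is now the base point, so all differences can only
            drop.\<close>
          fix j assume j: "0 < j" "j < m"
          have "bal (bal_period + j) = bal j + int bal_weight" "bal bal_period = int bal_weight"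
            using E_M[of j] E_M[of 0] by (simp_all add: add.commute)
          thus "bal_move bal_period (c + j) - bal_move bal_period c \<le> bal j"
            using Mm by (simp add: bal_move_def True)
        qed
      next
        case False
        obtain k where k: "c = k * bal_period" using dvd by (metis dvd_def mult.commute)
        have "k \<ge> 2" using False c k by (cases k; cases "k - 1") auto
        hence c2: "2 * bal_period \<le> c" unfolding k by (rule mult_right_mono) simp
        \<comment> \<open>Seen from \<open>c\<close>, the raised position comes at index
          \<open>i\<close>. It lies beyond \<open>bal_period\<close>, hence has a smaller weight
          than it has from the start 0.\<close>
        define i where "i = m + bal_period - c"
        have i: "0 < i" "i < m" "bal_period < i"
          using c2 c bal_period_pos unfolding i_def by linarith+
        have "val 1 (bal_move bal_period) c \<le> val 1 (bal_move i) 0"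
        proof (rule val_mono)
          fix j assume j: "0 < j" "j < m"
          have "bal (c + j) - bal c = bal j"
            using bal_add_period[OF bal_period_weight, of j k] bal_add_period[OF bal_period_weight, of 0 k] by (simp add: k add.commute)
          moreover have imp: "j = i" if "(c + j) mod m = bal_period"
          proof (cases "c + j < m")
            case True
            thus ?thesis using that c2 bal_period_pos by simp
          next
            case False
            hence "(c + j) mod m = c + j - m" using c j by (simp add: le_mod_geq)
            thus ?thesis using that False unfolding i_def by linarith
          qed
          moreover have "bal_move bal_period (c + j) - bal_move bal_period c \<le> bal (c + j) - bal c + of_bool ((c + j) mod m = bal_period)"
            by (simp add: bal_move_def)
          moreover have "bal_move i (0 + j) - bal_move i 0 = bal j + of_bool (j = i)"
            using j i by (simp add: bal_move_def)
          moreover have "of_bool ((c + j) mod m = bal_period) \<le> (of_bool (j = i) :: int)"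
            by (auto dest: imp)
          ultimately show "bal_move bal_period (c + j) - bal_move bal_period c \<le> bal_move i (0 + j) - bal_move i 0"
            by linarith
        qed simp
        also have "\<dots> = bal_val + int q ^ (m - 1 - i)" by (rule val_bal_move_0[OF i(1,2)])
        also have "\<dots> < int v" unfolding v(5) using i q
          by (intro add_strict_left_mono power_strict_increasing) auto
        finally show ?thesis .
      qed
    qed
    thus ?thesis unfolding v(4)[symmetric] by simp
  qed
  have "card (cyclotomic_coset q m n v) = m"
    using v(2) strict by (intro card_coset_full) (auto dest: less_imp_neq)
  moreover have "shift v c \<le> v" for c
  proof (cases "c mod m = 0")
    case True
    thus ?thesis using shift_mod[of v c] v(2) by simp
  next
    case False
    thus ?thesis using strict[of "c mod m"] m_pos by (simp add: shift_mod)
  qed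
  moreover have "s \<in> cyclotomic_coset q m n v \<or> (\<exists>c. v < shift s c)"
    if s: "0 < s" "s < n" "s \<notin> cyclotomic_coset q m n bal_residue" for s
  proof -
    obtain c where "v \<le> shift s c"
      using shift_ge_unbalanced[OF s Mm] unfolding v(5)[symmetric] by auto
    hence "v < shift s c \<or> v \<in> cyclotomic_coset q m n s" by (auto simp: mem_coset_iff)
    thus ?thesis using mem_coset_sym[of v s] s(2) by blast
  qed
  ultimately show ?thesis using v unfolding second_max_def by blast
qed

text \<open>A residue fixed by a proper shift has \<open>K >= 2\<close> when \<open>m\<close> and
  \<open>p\<close> are coprime. Its best rotation then has prefix sums at least the ceilings of
  \<open>2 * j * p / m\<close>, and these dominate every rotation of the balanced word with one
  moved unit. The larger \<open>K\<close> makes the inequality strict.\<close>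

lemma shift_bal_move_less:
  assumes Mm: "bal_period = m" and u: "0 < u" "u < n" and d: "0 < d" "d < m" "shift u d = u"
    and step: "bal (Suc a) = bal a + 1"
  shows "\<exists>c. \<forall>c'. val 1 (bal_move a) c' < int (shift u c)"
proof -
  define F where "F = digit_sums u"
  obtain K c where K: "K \<ge> 1" "quasi_periodic K F" "\<And>c. val K F c = int (shift u c)"
    "\<And>j. int (j * p) * K \<le> int m * (F (c + j) - F c)"
    using rotation_above[OF u] unfolding F_def by metis
  \<comment> \<open>The prefix sum at \<open>m * d\<close> is computed twice, by the period
    \<open>d\<close> and by the period \<open>m\<close>.\<close>
  have Fd: "F (i * d) = int i * F d" for i
    unfolding F_def
      by (induction i) (simp_all add: digit_sums_add[OF d(3)] add.commute[of d] distrib_right)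
  have Fm: "F (i * m) = int i * (int p * K)" for i
  proof (induction i)
    case (Suc i)
    have "F (Suc i * m) = F (i * m + m)" by (simp add: add.commute)
    thus ?case using Suc quasi_periodicD[OF K(2), of "i * m"] by (simp add: algebra_simps)
  qed (simp add: F_def)
  have "int m * F d = int d * (int p * K)"
    using Fd[of m] Fm[of d] by (simp add: mult.commute)
  hence "int m dvd int p * (int d * K)" by (metis dvd_triv_left mult.left_commute)
  moreover have "coprime (int m) (int p)"
  proof -
    have "gcd m p * m = 1 * m" using bal_period_mult Mm by (metis mult_1)
    hence "gcd m p = 1" using m_pos by (metis mult_right_cancel less_irrefl)
    hence "coprime m p" by (rule gcd_eq_1_imp_coprime)
    thus ?thesis by simp
  qed
  ultimately have mdK: "int m dvd int d * K" by (simp add: coprime_dvd_mult_right_iff)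
  \<comment> \<open>\<open>K = 1\<close> would make \<open>m\<close> divide \<open>d\<close>,
    although \<open>0 < d < m\<close>.\<close>
  have "K \<noteq> 1" using mdK d by (auto simp: nat_dvd_not_less)
  hence K2: "K \<ge> 2" using K(1) by simp
  have T: "ceil_div m (2 * (j * p)) \<le> F (c + j) - F c" for j
  proof -
    have "int (2 * (j * p)) = int (j * p) * 2" by simp
    also have "\<dots> \<le> int (j * p) * K" by (intro mult_left_mono K2) simp
    also note K(4)[of j]
    finally show ?thesis by (subst ceil_div_le_iff[OF m_pos])
  qed
  have ET: "bal j \<le> ceil_div m (2 * (j * p))" for j
  proof -
    have "int (j * p) \<le> int (2 * (j * p))" by simp
    also have "\<dots> \<le> int m * ceil_div m (2 * (j * p))"
      using ceil_div_le_iff[OF m_pos] by blast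
    finally show ?thesis by (simp add: bal_le_iff)
  qed
  show ?thesis
  proof (intro exI allI)
    fix c'
    have "val 1 (bal_move a) c' \<le> val 1 F c"
    proof (rule val_mono)
      fix j assume j: "0 < j" "j < m"
      have "bal_move a (c' + j) - bal_move a c' \<le> ceil_div m (2 * (j * p))"
      proof (cases "(c' + j) mod m = a")
        case False
        thus ?thesis using ET[of j] bal_subadd[of c' j] by (simp add: bal_move_def)
      next
        case True
        have "bal (c' + j) - bal c' + 1 \<le> ceil_div m (2 * (j * p))"
        \<comment> \<open>For larger \<open>j\<close>, doubling the slope raises the ceiling by at
          least one, which pays for the moved unit. For small \<open>j\<close> it need not, and the
          unit at position \<open>a\<close> is used instead.\<close>
        proof (cases "2 * (j * p) \<le> m")
          case False
          have "bal j < ceil_div m (2 * (j * p))"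
          proof (cases "j * p \<le> m")
            case True
            hence "bal j \<le> 1" unfolding bal_le_iff by (simp del: of_nat_mult)
            also have "1 < ceil_div m (2 * (j * p))"
              unfolding less_ceil_div_iff[OF m_pos] using False by (simp del: of_nat_mult)
            finally show ?thesis .
          next
            case False
            have "int m * (bal j - 1) < int (j * p)"
              using less_ceil_div_iff[OF m_pos, of "bal j - 1" "j * p"] by (simp add: bal_def)
            hence "int m * bal j < int (j * p) + int m"
              by (simp add: right_diff_distrib del: of_nat_mult)
            also have "\<dots> < int (2 * (j * p))" using False by (simp del: of_nat_mult)
            finally have "int m * bal j < int (2 * (j * p))" .
            thus ?thesis by (simp add: less_ceil_div_iff[OF m_pos])
          qed
          thus ?thesis using bal_subadd[of c' j] by simp
        next
          case le: True
          \<comment> \<open>The index after the raised position already counts the moved unit, so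
            \<open>bal (Suc j)\<close> bounds the modified difference.\<close>
          have "bal (Suc (c' + j)) \<le> bal c' + bal (Suc j)"
            using bal_subadd[of c' "Suc j"] by simp
          moreover have "bal (Suc (c' + j)) = bal (c' + j) + 1" by (rule bal_Suc_mod[OF step True])
          moreover have "bal (Suc j) \<le> 1"
          proof -
            have "p \<le> j * p" using j by simp
            hence "Suc j * p \<le> m" using le unfolding mult_Suc by linarith
            hence "int (Suc j * p) \<le> int m * 1" by (simp del: of_nat_mult mult_Suc)
            thus ?thesis unfolding bal_le_iff .
          qed
          moreover have "1 \<le> ceil_div m (2 * (j * p))"
            using less_ceil_div_iff[OF m_pos, of 0 "2 * (j * p)"] j p_pos by simp
          ultimately show ?thesis by linarith
        qed
        thus ?thesis by (simp add: bal_move_def)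
      qed
      thus "bal_move a (c' + j) - bal_move a c' \<le> F (c + j) - F c" using T[of j] by linarith
    qed simp
    also have "\<dots> < val K F c" using K2 by (simp add: val_def)
    finally show "val 1 (bal_move a) c' < int (shift u c)" by (simp add: K(3))
  qed
qed

text \<open>The runner-up is not identified: it is chosen to have the smallest maximum outside the
  coset of \<open>bal_residue\<close>. If a proper shift fixed it,
  \<open>shift_bal_move_less\<close> would put the whole coset of \<open>v\<close> below its
  maximum, against minimality.\<close>

lemma ex_second_max_coprime:
  assumes Mm: "bal_period = m"
  shows "\<exists>v. second_max v"
proof -
  \<comment> \<open>The position of the second unit of the balanced word. The first stands at 0,
    which \<open>shift_bal_move\<close> excludes.\<close>
  define a where "a = m div p"
  have ap: "a * p \<le> m" "m < Suc a * p" and a: "0 < a"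
    unfolding a_def
      using p_pos pm by (auto simp: div_greater_zero_iff dividend_less_div_times add.commute)
  have "a * 3 \<le> a * p" by (intro mult_left_mono p_pos) auto
  hence am: "a < m" using ap(1) a by linarith
  have "bal a \<le> 1" using ap(1) by (simp add: bal_le_iff del: of_nat_mult)
  moreover have "1 < bal (Suc a)"
    unfolding bal_def less_ceil_div_iff[OF m_pos] using ap(2) by (simp del: of_nat_mult mult_Suc)
  ultimately have step: "bal (Suc a) = bal a + 1" using bal_Suc_le[of a] by simp
  obtain v where v: "0 < v" "v < n" "v \<notin> cyclotomic_coset q m n bal_residue" "\<And>c. int (shift v c) = val 1 (bal_move a) c"
    using shift_bal_move[OF step a am] by metis
  define top where "top s = Max (cyclotomic_coset q m n s)" for s
  have fin: "finite (cyclotomic_coset q m n s)" for s by (simp add: cyclotomic_coset_def)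
  have shift_top: "shift s c \<le> top s" for s c
    unfolding top_def by (rule Max_ge[OF fin]) (auto simp: mem_coset_iff)
  have top_in: "\<exists>c. top s = shift s c" for s
  proof -
    have "top s \<in> cyclotomic_coset q m n s" unfolding top_def
      by (rule Max_in[OF fin]) (auto simp: coset_eq)
    thus ?thesis by (simp add: mem_coset_iff)
  qed
  define X where "X = {s. 0 < s \<and> s < n \<and> s \<notin> cyclotomic_coset q m n bal_residue}"
  have vX: "v \<in> X" using v by (simp add: X_def)
  define s where "s = (ARG_MIN top s. s \<in> X)"
  have sX: "s \<in> X" and smin: "\<And>t. t \<in> X \<Longrightarrow> top s \<le> top t"
    using arg_min_nat_lemma[of "\<lambda>s. s \<in> X" v top] vX unfolding s_def by auto
  define u where "u = top s"
  obtain c where c: "u = shift s c" using top_in unfolding u_def by blast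
  have u: "0 < u" "u < n" using sX shift_pos shift_less by (auto simp: c X_def)
  have u_mem: "u \<in> cyclotomic_coset q m n s" "s \<in> cyclotomic_coset q m n u"
    using c sX mem_coset_sym[of u s] by (auto simp: mem_coset_iff X_def)
  have uw: "u \<notin> cyclotomic_coset q m n bal_residue"
    using mem_coset_trans[OF u_mem(2)] sX by (auto simp: X_def)
  have u_max: "shift u c' \<le> u" for c'
    using shift_top[of s] unfolding c shift_add u_def[symmetric] by (simp add: c)
  have "shift u d \<noteq> u" if d: "0 < d" "d < m" for d
  proof
    assume ud: "shift u d = u"
    obtain c' where c': "\<And>c. val 1 (bal_move a) c < int (shift u c')"
      using shift_bal_move_less[OF Mm u d ud step] by metis
    obtain c'' where "top v = shift v c''" using top_in by blast
    hence "top v < shift u c'" using c'[of c''] v(4)[of c''] by simp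
    also have "\<dots> \<le> top s" using u_max unfolding u_def by blast
    finally show False using smin[OF vX] by simp
  qed
  hence "card (cyclotomic_coset q m n u) = m" using u(2) by (intro card_coset_full) auto
  moreover have "t \<in> cyclotomic_coset q m n u \<or> (\<exists>c. u < shift t c)"
    if t: "0 < t" "t < n" "t \<notin> cyclotomic_coset q m n bal_residue" for t
  proof -
    obtain e where e: "top t = shift t e" using top_in by blast
    have "u \<le> shift t e" using smin[of t] t unfolding u_def e[symmetric] by (simp add: X_def)
    hence "u < shift t e \<or> u \<in> cyclotomic_coset q m n t" by (auto simp: mem_coset_iff)
    thus ?thesis using mem_coset_sym[of u t] t(2) by blast
  qed
  ultimately have "second_max u" using u uw u_max unfolding second_max_def by blast
  thus ?thesis by blast
qed

lemma ex_second_max: "\<exists>v. second_max v"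
  using ex_second_max_periodic ex_second_max_coprime bal_period_le by (cases "bal_period = m") auto

section \<open>From coset maxima to coset leaders\<close>

text \<open>The two shifted residues are positive, below \<open>n\<close> and add up to a multiple
  of \<open>n\<close>, which can only be \<open>n\<close>.\<close>

lemma shift_complement:
  assumes "0 < t" "t < n"
  shows "shift (n - t) c = n - shift t c"
proof -
  have "(n - t) * q ^ c + t * q ^ c = n * q ^ c" using assms by (simp flip: distrib_right)
  hence "(shift (n - t) c + shift t c) mod n = 0" by (simp add: mod_simps)
  moreover have "0 < shift t c" "shift t c < n" "shift (n - t) c < n" "0 < shift (n - t) c"
    using shift_pos[of t c] shift_pos[of "n - t" c] assms shift_less by auto
  ultimately obtain k where k: "shift (n - t) c + shift t c = n * k"
    by (metis mod_0_imp_dvd dvd_def)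
  have "n * k < n * 2"
    using k \<open>shift t c < n\<close> \<open>shift (n - t) c < n\<close> by linarith
  moreover have "n * k > 0" using k \<open>0 < shift t c\<close> by linarith
  ultimately have "k = 1" by simp
  thus ?thesis using k by simp
qed

lemma coset_complement:
  assumes "0 < t" "t < n"
  shows "cyclotomic_coset q m n (n - t) = (\<lambda>x. n - x) ` cyclotomic_coset q m n t"
  unfolding coset_eq using shift_complement[OF assms] by (simp add: image_image)

lemma card_coset_complement:
  assumes "0 < t" "t < n"
  shows "card (cyclotomic_coset q m n (n - t)) = card (cyclotomic_coset q m n t)"
  unfolding coset_complement[OF assms]
proof (rule card_image, rule inj_onI)
  fix x y assume "x \<in> cyclotomic_coset q m n t" "y \<in> cyclotomic_coset q m n t" "n - x = n - y"
  moreover have "z < n" if "z \<in> cyclotomic_coset q m n t" for z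
    using that shift_less by (auto simp: mem_coset_iff)
  ultimately show "x = y" by (metis diff_diff_cancel less_imp_le)
qed

lemma mem_coset_complement:
  assumes "0 < s" "s < n" "0 < t" "t < n" "n - s \<in> cyclotomic_coset q m n (n - t)"
  shows "s \<in> cyclotomic_coset q m n t"
proof -
  obtain c where "n - s = n - shift t c"
    using assms(5) shift_complement[OF assms(3,4)] by (auto simp: mem_coset_iff)
  hence "s = shift t c" using assms shift_less[of t c] by linarith
  thus ?thesis by (auto simp: mem_coset_iff)
qed

lemma coset_cong:
  assumes "t \<in> cyclotomic_coset q m n l" "l < n"
  shows "cyclotomic_coset q m n t = cyclotomic_coset q m n l"
  using mem_coset_trans assms mem_coset_sym[OF assms] by blast

text \<open>All that the coding part uses about the leaders, which are
  \<open>n - bal_residue\<close> and \<open>n - v\<close> for a \<open>v\<close> with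
  \<open>second_max v\<close>. By the last conclusion the remaining nonzero cosets have
  representatives below \<open>l2\<close>, so they consist of prescribed zeros.\<close>

lemma coset_leaders_top_two:
  obtains l1 l2 where "nth_largest_leader q m n 1 = l1" "nth_largest_leader q m n 2 = l2"
    "0 < l2" "l2 < l1" "l1 < n"
    "card (cyclotomic_coset q m n l1) = m div gcd m p" "card (cyclotomic_coset q m n l2) = m"
    "l2 \<notin> cyclotomic_coset q m n l1"
    "\<And>x. x \<in> cyclotomic_coset q m n l1 \<Longrightarrow> l1 \<le> x" "\<And>x. x \<in> cyclotomic_coset q m n l2 \<Longrightarrow> l2 \<le> x"
    "\<And>t. 0 < t \<Longrightarrow> t < n \<Longrightarrow> t \<notin> cyclotomic_coset q m n l1 \<Longrightarrow> t \<notin> cyclotomic_coset q m n l2 \<Longrightarrow>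
      \<exists>x\<in>cyclotomic_coset q m n t. x < l2"
proof -
  let ?C = "cyclotomic_coset q m n"
  obtain v where v: "second_max v" using ex_second_max by blast
  have v1: "0 < v" "v < n" "v \<notin> ?C bal_residue" "card (?C v) = m" "\<And>c. shift v c \<le> v"
    "\<And>s. 0 < s \<Longrightarrow> s < n \<Longrightarrow> s \<notin> ?C bal_residue \<Longrightarrow> s \<in> ?C v \<or> (\<exists>c. v < shift s c)"
    using v unfolding second_max_def by auto
  have vw: "bal_residue < v"
  proof -
    obtain c where "bal_residue < shift v c" using shift_greater_bal_residue[OF v1(1-3)] by blast
    thus ?thesis using v1(5)[of c] by simp
  qed
  define l1 where "l1 = n - bal_residue"
  define l2 where "l2 = n - v"
  have l: "0 < l2" "l2 < l1" "l1 < n"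
    using vw bal_residue_pos bal_residue_less v1 unfolding l1_def l2_def by linarith+
  have c1: "card (?C l1) = m div gcd m p" and c2: "card (?C l2) = m"
    using card_coset_complement[OF bal_residue_pos bal_residue_less] card_coset_complement[OF v1(1,2)] card_coset_bal_residue v1(4)
    by (simp_all add: l1_def l2_def bal_period_def)
  have ge1: "l1 \<le> x" if x: "x \<in> ?C l1" for x
  proof -
    obtain c where "x = n - shift bal_residue c"
      using x shift_complement[OF bal_residue_pos bal_residue_less]
        unfolding l1_def mem_coset_iff by metis
    thus ?thesis unfolding l1_def using shift_bal_residue_le[of c] by (simp only: diff_le_mono2)
  qed
  have ge2: "l2 \<le> x" if x: "x \<in> ?C l2" for x
  proof -
    obtain c where "x = n - shift v c"
      using x shift_complement[OF v1(1,2)] unfolding l2_def mem_coset_iff by metis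
    thus ?thesis unfolding l2_def using v1(5)[of c] by (simp only: diff_le_mono2)
  qed
  have l2_l1: "l2 \<notin> ?C l1"
    using mem_coset_complement[OF v1(1,2) bal_residue_pos bal_residue_less] v1(3)
      by (auto simp: l1_def l2_def)
  have less: "\<exists>x\<in>?C t. x < l2" if t: "0 < t" "t < n" "t \<notin> ?C l1" "t \<notin> ?C l2" for t
  proof -
    have eq: "n - (n - t) = t" "n - (n - bal_residue) = bal_residue" "n - (n - v) = v"
      using t bal_residue_less v1 by simp_all
    have s: "0 < n - t" "n - t < n" using t by auto
    have "n - t \<notin> ?C bal_residue" "n - t \<notin> ?C v"
      using t(3,4) mem_coset_complement[OF t(1,2), of l1] mem_coset_complement[OF t(1,2), of l2] l
      using bal_residue_less v1(2) by (auto simp: l1_def l2_def eq)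
    then obtain c where c: "v < shift (n - t) c" using v1(6)[OF s] by blast
    hence "n - shift (n - t) c < l2" unfolding l2_def using shift_less[of "n - t" c] by linarith
    moreover have "n - shift (n - t) c = shift t c"
      using shift_complement[OF s, of c] by (simp add: eq)
    ultimately show ?thesis by (intro bexI[of _ "shift t c"]) (auto simp: mem_coset_iff)
  qed
  have fin: "finite (?C t)" for t by (simp add: cyclotomic_coset_def)
  have Min1: "Min (?C l1) = l1"
    using ge1 self_mem_coset[OF l(3)] by (intro Min_eqI fin) auto
  have Min2: "Min (?C l2) = l2"
    using ge2 self_mem_coset[of l2] l by (intro Min_eqI fin) auto
  have "rev (sorted_list_of_set (coset_leaders q m n)) ! 0 = l1 \<and>
    rev (sorted_list_of_set (coset_leaders q m n)) ! 1 = l2"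
  proof (rule rev_sorted_list_of_set_top_two)
    show "finite (coset_leaders q m n)" by (simp add: coset_leaders_def)
    show "l1 \<in> coset_leaders q m n" unfolding coset_leaders_def
      by (rule CollectI, rule exI[of _ l1]) (use Min1 l in simp)
    show "l2 \<in> coset_leaders q m n" unfolding coset_leaders_def
      by (rule CollectI, rule exI[of _ l2]) (use Min2 l in simp)
    show "l2 < l1" by fact
    fix z assume "z \<in> coset_leaders q m n"
    then obtain t where t: "t < n" "z = Min (?C t)" by (auto simp: coset_leaders_def)
    consider "t = 0" | "t \<in> ?C l1" | "t \<in> ?C l2" | "0 < t" "t \<notin> ?C l1" "t \<notin> ?C l2" by blast
    thus "z = l1 \<or> z = l2 \<or> z < l2"
    proof cases
      case 1
      hence "?C t = {0}" by (auto simp: coset_eq)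
      thus ?thesis using t l by simp
    next
      case 2
      thus ?thesis using coset_cong[OF 2 l(3)] t Min1 by simp
    next
      case 3
      thus ?thesis using coset_cong[OF 3] l t Min2 by simp
    next
      case 4
      then obtain x where x: "x \<in> ?C t" "x < l2" using less t by blast
      have "Min (?C t) \<le> x" using x fin by (intro Min_le)
      thus ?thesis using x t by simp
    qed
  qed
  hence "nth_largest_leader q m n 1 = l1" "nth_largest_leader q m n 2 = l2"
    by (simp_all add: nth_largest_leader_def)
  thus ?thesis using that l c1 c2 l2_l1 ge1 ge2 less by blast
qed

end

section \<open>Cyclic codes and minimal polynomials\<close>

text \<open>Multiplication by \<open>x\<close> permutes the nonzero elements, hence preserves their
  product.\<close>

lemma power_card_minus_1:
  fixes x :: "'a::{field,finite}"
  assumes "x \<noteq> 0"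
  shows "x ^ (CARD('a) - 1) = 1"
proof -
  have "\<Prod>(UNIV - {0}) = (\<Prod>y\<in>UNIV - {0}. x * y)"
    by (rule prod.reindex_bij_witness[of _ "\<lambda>y. x * y" "\<lambda>y. y / x"]) (use assms in auto)
  also have "\<dots> = x ^ (CARD('a) - 1) * \<Prod>(UNIV - {0})"
    by (simp add: prod.distrib)
  finally show ?thesis by simp
qed

lemma power_card:
  fixes x :: "'a::{field,finite}"
  shows "x ^ CARD('a) = x"
proof (cases "x = 0")
  case False
  have "CARD('a) = Suc (CARD('a) - 1)" using finite_UNIV_card_ge_0[where 'a='a] by simp
  thus ?thesis using power_card_minus_1[OF False] by (metis mult.right_neutral power_Suc)
qed simp

text \<open>Translation by 1 permutes the field, hence preserves the sum of its elements.\<close>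

lemma of_nat_card_eq_0: "of_nat (CARD('a)) = (0 :: 'a::{field,finite})"
proof -
  have "(\<Sum>x\<in>UNIV. x) = (\<Sum>x\<in>UNIV. x + 1 :: 'a)"
    by (rule sum.reindex_bij_witness[of _ "\<lambda>x. x + 1" "\<lambda>x. x - 1"]) auto
  thus ?thesis by (simp add: sum.distrib)
qed

lemma card_roots_power_eq_self:
  assumes "q > 1"
  shows "finite {x :: 'a::field. x ^ q = x}" "card {x :: 'a::field. x ^ q = x} \<le> q"
proof -
  define p :: "'a poly" where "p = monom 1 q - monom 1 1"
  have "coeff p q = 1" using assms by (simp add: p_def)
  hence p0: "p \<noteq> 0" by auto
  have "{x. poly p x = 0} = {x. x ^ q = x}" by (simp add: p_def poly_monom)
  moreover have "degree p \<le> q"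
    unfolding p_def
      by (rule degree_diff_le) (use assms in \<open>auto simp: degree_monom_eq\<close>)
  ultimately show "finite {x :: 'a. x ^ q = x}" "card {x :: 'a. x ^ q = x} \<le> q"
    using poly_roots_finite[OF p0] card_poly_roots_bound[OF p0] by auto
qed

lemma poly_coprime_linear_prod_dvd:
  fixes f :: "'a::field poly"
  assumes "finite S" "\<And>y. y \<in> S \<Longrightarrow> poly f y = 0"
  shows "(\<Prod>y\<in>S. [:- y, 1:]) dvd f"
  using assms
proof (induction S arbitrary: f rule: finite_induct)
  case (insert x S)
  obtain g where g: "f = [:- x, 1:] * g"
    using insert.prems[of x] by (auto simp: poly_eq_0_iff_dvd dvd_def)
  have "poly g y = 0" if "y \<in> S" for y
  proof -
    have "poly f y = 0" "y \<noteq> x" using insert that by auto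
    thus ?thesis by (simp add: g)
  qed
  hence "(\<Prod>y\<in>S. [:- y, 1:]) dvd g" by (rule insert.IH)
  thus ?case unfolding prod.insert[OF insert.hyps] g by (rule mult_dvd_mono[OF dvd_refl])
qed simp

lemma monic_dvd_same_degree:
  fixes f g :: "'a::field poly"
  assumes "f dvd g" "degree g \<le> degree f" "lead_coeff f = 1" "lead_coeff g = 1"
  shows "f = g"
proof -
  obtain u where u: "g = f * u" using assms(1) by (auto simp: dvd_def)
  have "f \<noteq> 0" "u \<noteq> 0" using assms(3,4) u by auto
  hence "degree u = 0" using assms(2) by (simp add: u degree_mult_eq)
  then obtain c where c: "u = [:c:]" by (rule degree_eq_zeroE)
  have "lead_coeff g = lead_coeff f * lead_coeff u" by (simp only: u lead_coeff_mult)
  hence "c = 1" using assms(3,4) by (simp add: c)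
  thus ?thesis by (simp add: u c)
qed

section \<open>Frobenius, descent and minimal polynomials\<close>

locale finite_field_extension = field_hom h
  for h :: "'k::{field,finite} \<Rightarrow> 'l::{field,finite}" +
  fixes q :: nat
  assumes primepow_q: "primepow q" and card_k: "CARD('k) = q"
begin

lemma q_gt_1: "q > 1"
  using primepow_gt_Suc_0[OF primepow_q] by simp

text \<open>As \<open>q\<close> vanishes in the small field, it does so in the large one. The
  characteristic therefore divides the prime power \<open>q\<close> and is its prime.\<close>

lemma freshman: "(x + y :: 'l) ^ q = x ^ q + y ^ q"
proof -
  obtain r e where r: "prime r" "q = r ^ e" using primepow_q by (auto simp: primepow_def)
  have "(of_nat q :: 'l) = h (of_nat q)" by (simp add: hom_distribs)
  also have "of_nat q = (0 :: 'k)" using of_nat_card_eq_0[where 'a='k] by (simp add: card_k)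
  finally have "of_nat q = (0 :: 'l)" by simp
  hence dvd: "CHAR('l) dvd q" by (simp add: of_nat_eq_0_iff_char_dvd)
  have "CHAR('l) > 0" using dvd q_gt_1 by (intro Nat.gr0I) auto
  hence prime: "prime CHAR('l)" by (rule prime_CHAR_semidom)
  hence "CHAR('l) = r" using dvd r by (metis prime_dvd_power primes_dvd_imp_eq)
  thus ?thesis using freshmans_dream'[OF prime, of q e] r by simp
qed

lemma frobenius_hom: "field_hom (\<lambda>x::'l. x ^ q)"
  using q_gt_1 by unfold_locales (auto simp: freshman power_mult_distrib)

lemma h_power_q: "h c ^ q = h c"
  using power_card[of c] by (simp add: card_k flip: hom_power)

lemma range_h: "range h = {x. x ^ q = x}"
proof (rule card_seteq)
  show "finite {x :: 'l. x ^ q = x}" "range h \<subseteq> {x. x ^ q = x}" using h_power_q by auto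
  have "inj h" by (auto intro: injI)
  hence "card (range h) = q" by (simp add: card_image card_k)
  thus "card {x :: 'l. x ^ q = x} \<le> card (range h)"
    using card_roots_power_eq_self(2)[OF q_gt_1, where 'a='l] by simp
qed

definition frob_closed :: "'l set \<Rightarrow> bool" where
  "frob_closed S \<longleftrightarrow> (\<forall>y\<in>S. y ^ q \<in> S)"

text \<open>The Frobenius map permutes \<open>S\<close>, so it fixes the product of linear factors
  and with it each coefficient; its fixed points are the image of \<open>h\<close>.\<close>

lemma ex_descent:
  assumes "frob_closed S"
  shows "\<exists>P. map_poly h P = (\<Prod>y\<in>S. [:- y, 1:])"
proof -
  interpret frob: field_hom "\<lambda>x::'l. x ^ q" by (rule frobenius_hom)
  interpret mfrob: map_poly_comm_ring_hom "\<lambda>x::'l. x ^ q" ..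
  let ?p = "\<Prod>y\<in>S. [:- y, 1:]"
  have inj: "inj_on (\<lambda>y::'l. y ^ q) S" by (rule inj_onI) simp
  moreover have "(\<lambda>y::'l. y ^ q) ` S \<subseteq> S"
    using assms by (auto simp: frob_closed_def)
  ultimately have img: "(\<lambda>y. y ^ q) ` S = S" by (intro endo_inj_surj) auto
  have "map_poly (\<lambda>x. x ^ q) ?p = (\<Prod>y\<in>S. map_poly (\<lambda>x. x ^ q) [:- y, 1:])"
    by (rule mfrob.hom_prod)
  also have "\<dots> = (\<Prod>y\<in>S. [:- (y ^ q), 1:])"
    by (intro prod.cong refl) (simp add: frob.map_poly_pCons_hom frob.hom_uminus)
  also have "\<dots> = (\<Prod>y\<in>(\<lambda>y. y ^ q) ` S. [:- y, 1:])"
    by (simp add: prod.reindex[OF inj])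
  also have "\<dots> = ?p" by (simp only: img)
  finally have "coeff ?p i ^ q = coeff ?p i" for i
    by (metis frob.coeff_map_poly_hom)
  hence "coeff ?p i \<in> range h" for i by (simp add: range_h)
  hence inv_h: "h (inv_into UNIV h (coeff ?p i)) = coeff ?p i" for i by (simp add: f_inv_into_f)
  have "inv_into UNIV h (h 0) = 0" by (rule inv_f_f)
  hence inv_0: "inv_into UNIV h 0 = 0" by simp
  hence "map_poly h (map_poly (inv_into UNIV h) ?p) = ?p"
    by (intro poly_eqI) (simp only: coeff_map_poly_hom coeff_map_poly[where f = "inv_into UNIV h"] inv_0 inv_h)
  thus ?thesis by blast
qed

text \<open>Meaningful only for Frobenius-closed \<open>S\<close>, where \<open>ex_descent\<close>
  provides the polynomial.\<close>

definition vanishing_poly :: "'l set \<Rightarrow> 'k poly" where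
  "vanishing_poly S = (SOME P. map_poly h P = (\<Prod>y\<in>S. [:- y, 1:]))"

lemma map_vanishing_poly:
  "frob_closed S \<Longrightarrow> map_poly h (vanishing_poly S) = (\<Prod>y\<in>S. [:- y, 1:])"
  unfolding vanishing_poly_def by (rule someI_ex) (rule ex_descent)

lemma degree_vanishing_poly: "frob_closed S \<Longrightarrow> degree (vanishing_poly S) = card S"
  using arg_cong[OF map_vanishing_poly, of S degree] by (simp add: degree_prod_sum_eq)

lemma monic_vanishing_poly:
  assumes "frob_closed S" shows "lead_coeff (vanishing_poly S) = 1"
proof -
  have "h (lead_coeff (vanishing_poly S)) = lead_coeff (\<Prod>y\<in>S. [:- y, 1:])"
    by (simp only: map_vanishing_poly[OF assms, symmetric] hom_lead_coeff)
  also have "\<dots> = 1" by (simp add: lead_coeff_prod)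
  finally show ?thesis by (simp only: hom_1_iff)
qed

lemma vanishing_poly_dvd_iff:
  assumes "frob_closed S"
  shows "vanishing_poly S dvd f \<longleftrightarrow> (\<forall>y\<in>S. poly (map_poly h f) y = 0)"
proof
  interpret mh: map_poly_comm_ring_hom h ..
  assume "vanishing_poly S dvd f"
  hence "map_poly h (vanishing_poly S) dvd map_poly h f" by (rule mh.hom_dvd)
  thus "\<forall>y\<in>S. poly (map_poly h f) y = 0"
    unfolding map_vanishing_poly[OF assms] by (auto elim!: dvdE simp: poly_prod)
next
  assume "\<forall>y\<in>S. poly (map_poly h f) y = 0"
  hence "map_poly h (vanishing_poly S) dvd map_poly h f"
    unfolding map_vanishing_poly[OF assms] by (intro poly_coprime_linear_prod_dvd) auto
  thus "vanishing_poly S dvd f" by (rule dvd_map_poly_hom_imp_dvd)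
qed

lemma poly_vanishing_poly: "frob_closed S \<Longrightarrow> poly (map_poly h (vanishing_poly S)) y = 0 \<longleftrightarrow> y \<in> S"
  by (simp add: map_vanishing_poly poly_prod)

lemma root_power_q:
  assumes "poly (map_poly h f) x = 0"
  shows "poly (map_poly h f) (x ^ q ^ i) = 0"
proof (induction i)
  case (Suc i)
  interpret frob: field_hom "\<lambda>x::'l. x ^ q" by (rule frobenius_hom)
  have "map_poly (\<lambda>x. x ^ q) (map_poly h f) = map_poly h f"
    by (intro poly_eqI) (simp add: h_power_q)
  hence "poly (map_poly h f) ((x ^ q ^ i) ^ q) = (poly (map_poly h f) (x ^ q ^ i)) ^ q"
    using frob.poly_map_poly[of "map_poly h f" "x ^ q ^ i"] by simp
  thus ?case using Suc q_gt_1 by (simp add: mult.commute flip: power_mult)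
qed (use assms in simp)

definition conjugates :: "'l \<Rightarrow> 'l set" where
  "conjugates x = range (\<lambda>i. x ^ q ^ i)"

lemma frob_closed_conjugates: "frob_closed (conjugates x)"
  unfolding frob_closed_def conjugates_def
proof safe
  fix i show "(x ^ q ^ i) ^ q \<in> range (\<lambda>i. x ^ q ^ i)"
    by (rule range_eqI[of _ _ "Suc i"]) (simp add: mult.commute flip: power_mult)
qed

lemma frob_closed_Union: "(\<And>S. S \<in> T \<Longrightarrow> frob_closed S) \<Longrightarrow> frob_closed (\<Union>T)"
  by (auto simp: frob_closed_def)

text \<open>A polynomial over the small field that vanishes at \<open>x\<close> vanishes at all its
  conjugates, so it is a multiple of their vanishing polynomial.\<close>

lemma min_poly_eq: "min_poly h x = vanishing_poly (conjugates x)"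
  unfolding min_poly_def
proof (rule the_equality)
  let ?P = "vanishing_poly (conjugates x)"
  have "x = x ^ q ^ 0" by simp
  hence x: "x \<in> conjugates x" unfolding conjugates_def by blast
  have root: "poly (map_poly h ?P) x = 0"
    using x by (simp add: poly_vanishing_poly frob_closed_conjugates)
  have dvd: "?P dvd r" if "poly (map_poly h r) x = 0" for r
    using root_power_q[OF that] unfolding vanishing_poly_dvd_iff[OF frob_closed_conjugates]
    by (auto simp: conjugates_def)
  have monic: "lead_coeff ?P = 1" by (rule monic_vanishing_poly[OF frob_closed_conjugates])
  show "lead_coeff ?P = 1 \<and> poly (map_poly h ?P) x = 0 \<and>
     (\<forall>r. r \<noteq> 0 \<longrightarrow> poly (map_poly h r) x = 0 \<longrightarrow> degree ?P \<le> degree r)"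
    using root monic dvd by (auto intro: dvd_imp_degree_le)
  fix p assume p: "lead_coeff p = 1 \<and> poly (map_poly h p) x = 0 \<and>
     (\<forall>r. r \<noteq> 0 \<longrightarrow> poly (map_poly h r) x = 0 \<longrightarrow> degree p \<le> degree r)"
  have "?P \<noteq> 0" using monic by auto
  hence "degree p \<le> degree ?P" using p root by blast
  thus "p = ?P" using monic_dvd_same_degree[OF dvd _ monic] p by metis
qed

text \<open>A common multiple is a polynomial vanishing on each member of \<open>T\<close>, that is,
  on the union.\<close>

lemma monic_Lcm_vanishing_poly:
  assumes "\<And>S. S \<in> T \<Longrightarrow> frob_closed S"
  shows "monic_Lcm (vanishing_poly ` T) = vanishing_poly (\<Union>T)"
  unfolding monic_Lcm_def
proof (rule the_equality)
  let ?g = "vanishing_poly (\<Union>T)"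
  have cl: "frob_closed (\<Union>T)" using assms by (rule frob_closed_Union)
  have *: "lead_coeff ?g = 1 \<and> (\<forall>p\<in>vanishing_poly ` T. p dvd ?g) \<and>
      (\<forall>f. (\<forall>p\<in>vanishing_poly ` T. p dvd f) \<longrightarrow> ?g dvd f)"
    using assms cl by (auto simp: monic_vanishing_poly vanishing_poly_dvd_iff poly_vanishing_poly)
  thus "lead_coeff ?g = 1 \<and> (\<forall>p\<in>vanishing_poly ` T. p dvd ?g) \<and>
      (\<forall>f. (\<forall>p\<in>vanishing_poly ` T. p dvd f) \<longrightarrow> ?g dvd f)" .
  fix g assume g: "lead_coeff g = 1 \<and> (\<forall>p\<in>vanishing_poly ` T. p dvd g) \<and>
      (\<forall>f. (\<forall>p\<in>vanishing_poly ` T. p dvd f) \<longrightarrow> g dvd f)"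
  hence "g dvd ?g" "?g dvd g" using * by blast+
  thus "g = ?g" using g * by (intro poly_dvd_antisym) auto
qed

end

section \<open>Cyclic codes and their dimension\<close>

text \<open>As \<open>g\<close> divides the modulus, reduction keeps multiples of \<open>g\<close>;
  a multiple of degree below \<open>n\<close> is its own residue.\<close>

lemma cyclic_code_eq:
  fixes g :: "'k::field poly"
  assumes n: "n > 0" and g: "g dvd monom 1 n - 1"
  shows "cyclic_code n g = {c. g dvd c \<and> (\<forall>i\<ge>n. coeff c i = 0)}"
proof -
  define X :: "'k poly" where "X = monom 1 n - 1"
  have deg: "degree X = n"
    unfolding X_def diff_conv_add_uminus using n
    by (subst degree_add_eq_left) (auto simp: degree_monom_eq)
  hence X0: "X \<noteq> 0" using n by auto
  have dvd: "g dvd (g * f) mod X" for f using g by (simp add: dvd_mod_iff X_def)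
  have high: "coeff ((g * f) mod X) i = 0" if "i \<ge> n" for f i
    using degree_mod_less[OF X0, of "g * f"] that deg
    by (cases "(g * f) mod X = 0") (auto intro: coeff_eq_0)
  have "c \<in> cyclic_code n g" if c: "g dvd c" "\<forall>i\<ge>n. coeff c i = 0" for c
  proof -
    obtain f where f: "c = g * f" using c by (auto simp: dvd_def)
    have "c = 0 \<or> degree c < n" using c(2) leading_coeff_neq_0 not_le by blast
    hence "c mod X = c" using deg mod_poly_less[of c X] by auto
    thus ?thesis unfolding cyclic_code_def X_def[symmetric] f by (intro CollectI exI[of _ f]) auto
  qed
  thus ?thesis using dvd high unfolding cyclic_code_def X_def[symmetric] by auto
qed

lemma linear_code_cyclic_code:
  fixes g :: "'k::field poly"
  assumes "n > 0" "g dvd monom 1 n - 1"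
  shows "linear_code n (cyclic_code n g)"
proof -
  interpret vector_space "Polynomial.smult :: 'k \<Rightarrow> 'k poly \<Rightarrow> 'k poly"
    by (rule vector_space_smult)
  show ?thesis
    unfolding linear_code_def cyclic_code_eq[OF assms] subspace_def by (auto intro: dvd_smult)
qed

text \<open>The products of \<open>g\<close> with the monomials of degree below
  \<open>n - degree g\<close> form a basis.\<close>

lemma code_dim_cyclic_code:
  fixes g :: "'k::field poly"
  assumes n: "n > 0" and g: "g dvd monom 1 n - 1" "g \<noteq> 0"
  shows "code_dim (cyclic_code n g) = n - degree g"
proof -
  interpret vector_space "Polynomial.smult :: 'k \<Rightarrow> 'k poly \<Rightarrow> 'k poly"
    by (rule vector_space_smult)
  define b :: "nat \<Rightarrow> 'k poly" where "b i = g * monom 1 i" for i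
  define k where "k = n - degree g"
  have deg_b: "degree (b i) = degree g + i" for i
    unfolding b_def using g by (subst degree_mult_eq) (auto simp: degree_monom_eq monom_eq_0_iff)
  have inj: "inj_on b {..<k}"
    using deg_b by (intro inj_onI) (metis add_left_cancel)
  have comb: "(\<Sum>i<k. Polynomial.smult (u i) (b i)) = g * (\<Sum>i<k. monom (u i) i)" for u
    by (simp add: b_def sum_distrib_left smult_monom flip: mult_smult_right)
  have "dim (cyclic_code n g) = k"
  proof (rule dim_unique[of "b ` {..<k}"])
    show "b ` {..<k} \<subseteq> cyclic_code n g"
      unfolding cyclic_code_eq[OF n g(1)] using deg_b
      by (auto simp: k_def b_def intro!: coeff_eq_0)
    show "cyclic_code n g \<subseteq> span (b ` {..<k})"
    proof
      fix c assume "c \<in> cyclic_code n g"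
      hence c: "g dvd c" "\<forall>i\<ge>n. coeff c i = 0"
        unfolding cyclic_code_eq[OF n g(1)] by auto
      obtain f where f: "c = g * f" using c by (auto simp: dvd_def)
      have "f = (\<Sum>i<k. monom (coeff f i) i)"
      proof (cases "f = 0")
        case False
        have "c \<noteq> 0" using False g(2) f by simp
        hence "degree c < n" using c(2) by (metis leading_coeff_0_iff not_le)
        hence "degree f < k" using False g(2) by (simp add: f degree_mult_eq k_def)
        show ?thesis
        proof (rule poly_eqI)
          fix j
          show "coeff f j = coeff (\<Sum>i<k. monom (coeff f i) i) j"
            using \<open>degree f < k\<close> by (auto simp: coeff_sum coeff_eq_0)
        qed
      qed simp
      hence "c = (\<Sum>i<k. Polynomial.smult (coeff f i) (b i))" using comb[of "coeff f"] f by simp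
      moreover have "(\<Sum>i<k. Polynomial.smult (coeff f i) (b i)) \<in> span (b ` {..<k})"
        by (intro span_sum span_scale span_base imageI)
      ultimately show "c \<in> span (b ` {..<k})" by simp
    qed
    show "independent (b ` {..<k})"
    proof (rule independent_if_scalars_zero)
      fix u x assume u: "(\<Sum>x\<in>b ` {..<k}. Polynomial.smult (u x) x) = 0"
        and x: "x \<in> b ` {..<k}"
      have "g * (\<Sum>i<k. monom (u (b i)) i) = 0"
        using u comb[of "u \<circ> b"] by (simp add: sum.reindex[OF inj])
      hence z: "(\<Sum>i<k. monom (u (b i)) i) = 0" using g(2) by simp
      obtain i where i: "i < k" "x = b i" using x by auto
      have "coeff (\<Sum>i<k. monom (u (b i)) i) i = u (b i)" using i by (simp add: coeff_sum)
      thus "u x = 0" by (simp add: z i)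
    qed simp
    show "card (b ` {..<k}) = k" by (simp add: card_image[OF inj])
  qed
  thus ?thesis by (simp add: code_dim_def k_def)
qed

section \<open>Minimum distance\<close>

text \<open>A substitute for the Vandermonde determinant: a polynomial \<open>L\<close> vanishing at
  all support points but one combines the prescribed zeros of \<open>c\<close> into an equation that
  isolates a single nonzero coefficient.\<close>

lemma bch_bound:
  fixes c :: "'l::field poly"
  assumes inj: "inj_on (\<lambda>i. \<beta> ^ i) {..<n}" and "\<beta> \<noteq> 0"
    and c: "c \<noteq> 0" "\<forall>i\<ge>n. coeff c i = 0"
    and roots: "\<And>j. j \<in> {1..\<delta> - 1} \<Longrightarrow> poly c (\<beta> ^ j) = 0"
  shows "\<delta> \<le> card {i. coeff c i \<noteq> 0}"
proof (rule ccontr)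
  define A where "A = {i. coeff c i \<noteq> 0}"
  assume "\<not> ?thesis"
  hence card_A: "card A < \<delta>" by (simp add: A_def)
  have A_n: "A \<subseteq> {..<n}" using c(2) by (force simp: A_def not_le[symmetric])
  hence finA: "finite A" by (rule finite_subset) simp
  have poly_c: "poly c y = (\<Sum>i\<in>A. coeff c i * y ^ i)" for y
  proof -
    have "(\<Sum>i\<le>degree c. coeff c i * y ^ i) = (\<Sum>i\<in>A. coeff c i * y ^ i)"
      by (rule sum.mono_neutral_right) (auto simp: A_def le_degree)
    thus ?thesis by (simp add: poly_altdef)
  qed
  obtain i0 where i0: "i0 \<in> A" using c(1) by (auto simp: A_def poly_eq_iff)
  define L where "L = (\<Prod>i\<in>A - {i0}. [:- (\<beta> ^ i), 1:])"
  have "degree L = card A - 1"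
    unfolding L_def using i0 finA by (subst degree_prod_sum_eq) (auto simp: card_Diff_singleton)
  moreover have "card A > 0" using i0 finA by (auto simp: card_gt_0_iff)
  ultimately have deg_L: "degree L + 1 < \<delta>" using card_A by simp
  \<comment> \<open>The extra factor \<open>\<beta> ^ i\<close> shifts the exponents by one, so that
    the zeros used start at \<open>\<beta> ^ 1\<close>.\<close>
  have "(\<Sum>i\<in>A. coeff c i * \<beta> ^ i * poly L (\<beta> ^ i))
      = (\<Sum>i\<in>A. \<Sum>k\<le>degree L. coeff L k * (coeff c i * (\<beta> ^ (k + 1)) ^ i))"
    by (intro sum.cong refl)
      (simp add: poly_altdef sum_distrib_left power_add mult_ac power_mult_distrib flip: power_mult)
  also have "\<dots> = (\<Sum>k\<le>degree L. coeff L k * poly c (\<beta> ^ (k + 1)))"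
    unfolding poly_c sum_distrib_left by (rule sum.swap)
  also have "\<dots> = 0"
  proof (intro sum.neutral ballI)
    fix k assume "k \<in> {..degree L}"
    hence "poly c (\<beta> ^ (k + 1)) = 0" using deg_L by (intro roots) auto
    thus "coeff L k * poly c (\<beta> ^ (k + 1)) = 0" by (simp only: mult_zero_right)
  qed
  finally have "(\<Sum>i\<in>A. coeff c i * \<beta> ^ i * poly L (\<beta> ^ i)) = 0" .
  moreover have "(\<Sum>i\<in>A. coeff c i * \<beta> ^ i * poly L (\<beta> ^ i)) = coeff c i0 * \<beta> ^ i0 * poly L (\<beta> ^ i0)"
  proof -
    have "poly L (\<beta> ^ i) = 0" if "i \<in> A - {i0}" for i
      using that finA by (auto simp: L_def poly_prod)
    thus ?thesis using i0 finA by (subst sum.remove[of _ i0]) auto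
  qed
  moreover have "poly L (\<beta> ^ i0) \<noteq> 0"
  proof -
    have "\<beta> ^ i0 \<noteq> \<beta> ^ i" if "i \<in> A - {i0}" for i
      using inj_onD[OF inj, of i0 i] that i0 A_n by auto
    thus ?thesis using finA by (auto simp: L_def poly_prod)
  qed
  ultimately show False using i0 \<open>\<beta> \<noteq> 0\<close> by (auto simp: A_def)
qed

text \<open>\<open>Min\<close> needs a finite nonempty set: distances are at most \<open>n\<close>,
  and the nonzero word \<open>c\<close> against 0 provides one.\<close>

lemma min_dist_ge:
  assumes "0 \<in> C" "c \<in> C" "c \<noteq> 0"
    and len: "\<And>c i. c \<in> C \<Longrightarrow> i \<ge> n \<Longrightarrow> coeff c i = 0"
    and diff: "\<And>c d. c \<in> C \<Longrightarrow> d \<in> C \<Longrightarrow> c - d \<in> C"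
    and ge: "\<And>c. c \<in> C \<Longrightarrow> c \<noteq> 0 \<Longrightarrow> \<delta> \<le> card {i. coeff c i \<noteq> 0}"
  shows "\<delta> \<le> min_dist C"
proof -
  define H where "H = {hamming_dist c d |c d. c \<in> C \<and> d \<in> C \<and> c \<noteq> d}"
  have eq: "hamming_dist c d = card {i. coeff (c - d) i \<noteq> 0}" for c d :: "'a poly"
    by (simp add: hamming_dist_def)
  have "H \<subseteq> {..n}"
  proof
    fix x assume "x \<in> H"
    then obtain c d where x: "c \<in> C" "d \<in> C" "x = hamming_dist c d" by (auto simp: H_def)
    have "{i. coeff (c - d) i \<noteq> 0} \<subseteq> {..<n}"
      using len[OF diff[OF x(1,2)]] by (auto simp: not_le[symmetric])
    from card_mono[OF _ this] show "x \<in> {..n}" by (simp add: x(3) eq)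
  qed
  hence "finite H" by (rule finite_subset) simp
  moreover have "H \<noteq> {}" using assms(1-3) by (auto simp: H_def)
  moreover have "\<delta> \<le> x" if "x \<in> H" for x
    using that ge diff by (auto simp: H_def eq simp del: coeff_diff)
  ultimately have "\<delta> \<le> Min H" by simp
  thus ?thesis by (simp add: min_dist_def H_def)
qed

section \<open>BCH codes\<close>

text \<open>\<open>J\<close> is the set of exponents of the zeros of the generator; its size is the
  degree of the generator. \<open>card J < n\<close> keeps the code from being zero.\<close>

lemma (in finite_field_extension) bch_code_parameters:
  assumes inj: "inj_on (\<lambda>i. \<beta> ^ i) {..<n}"
    and \<beta>: "\<beta> ^ n = 1" and n: "n > 0"
    and coset: "\<And>s x. x \<in> cyclotomic_coset q m n s \<longleftrightarrow> (\<exists>c. x = s * q ^ c mod n)"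
    and J: "J = (\<Union>i\<in>{1..\<delta> - 1}. cyclotomic_coset q m n i)" "card J < n"
  shows "linear_code n (bch_code h n \<beta> \<delta>)" "code_dim (bch_code h n \<beta> \<delta>) = n - card J"
    "\<delta> \<le> min_dist (bch_code h n \<beta> \<delta>)"
proof -
  have \<beta>_mod: "\<beta> ^ (k mod n) = \<beta> ^ k" for k
  proof -
    have "\<beta> ^ k = \<beta> ^ (n * (k div n) + k mod n)" by simp
    also have "\<dots> = \<beta> ^ (k mod n)"
      by (simp only: power_add power_mult \<beta> power_one mult_1)
    finally show ?thesis ..
  qed
  have \<beta>0: "\<beta> \<noteq> 0" using \<beta> n by (auto simp: power_0_left)
  have conj: "conjugates (\<beta> ^ i) = (\<lambda>j. \<beta> ^ j) ` cyclotomic_coset q m n i" for i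
  proof -
    have "cyclotomic_coset q m n i = range (\<lambda>c. i * q ^ c mod n)" using coset by auto
    thus ?thesis by (simp add: conjugates_def image_image \<beta>_mod power_mult)
  qed
  define S where "S = (\<lambda>j. \<beta> ^ j) ` J"
  define T where "T = (\<lambda>i. conjugates (\<beta> ^ i)) ` {1..\<delta> - 1}"
  have T: "frob_closed R" if "R \<in> T" for R
    using that frob_closed_conjugates by (auto simp: T_def)
  have "\<Union>T = S" by (simp add: T_def S_def J(1) conj image_UN)
  hence S: "frob_closed S" using frob_closed_Union[of T] T by metis
  define g where "g = vanishing_poly S"
  have "(\<lambda>j. min_poly h (\<beta> ^ j)) ` {1..\<delta> - 1} = vanishing_poly ` T"
    by (simp add: T_def image_image min_poly_eq)
  hence bch: "bch_code h n \<beta> \<delta> = cyclic_code n g"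
    unfolding bch_code_def g_def
      using monic_Lcm_vanishing_poly[OF T] by (simp add: \<open>\<Union>T = S\<close>)
  have g_monic: "lead_coeff g = 1" unfolding g_def by (rule monic_vanishing_poly[OF S])
  hence g0: "g \<noteq> 0" by auto
  have J_n: "J \<subseteq> {..<n}" using n by (auto simp: J(1) coset)
  have "card S = card J" unfolding S_def by (rule card_image[OF inj_on_subset[OF inj J_n]])
  hence deg_g: "degree g = card J" unfolding g_def by (simp add: degree_vanishing_poly[OF S])
  interpret mh: map_poly_comm_ring_hom h ..
  have g_dvd: "g dvd monom 1 n - 1"
    unfolding g_def vanishing_poly_dvd_iff[OF S]
  proof
    fix y assume "y \<in> S"
    then obtain j where "y = \<beta> ^ j" by (auto simp: S_def)
    hence "y ^ n = 1" by (metis \<beta> mult.commute power_mult power_one)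
    thus "poly (map_poly h (monom 1 n - 1)) y = 0"
      by (simp add: mh.hom_minus poly_monom)
  qed
  show lin: "linear_code n (bch_code h n \<beta> \<delta>)"
    unfolding bch by (rule linear_code_cyclic_code[OF n g_dvd])
  show "code_dim (bch_code h n \<beta> \<delta>) = n - card J"
    unfolding bch code_dim_cyclic_code[OF n g_dvd g0] deg_g ..
  note code = cyclic_code_eq[OF n g_dvd]
  show "\<delta> \<le> min_dist (bch_code h n \<beta> \<delta>)"
    unfolding bch
  \<comment> \<open>The generator itself serves as the nonzero codeword.\<close>
  proof (rule min_dist_ge[where c = g and n = n])
    show "0 \<in> cyclic_code n g" "g \<in> cyclic_code n g"
      using J(2) deg_g by (auto simp: code coeff_eq_0)
    show "g \<noteq> 0" by (rule g0)
    show "coeff c i = 0" if "c \<in> cyclic_code n g" "i \<ge> n" for c i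
      using that by (auto simp: code)
    show "c - d \<in> cyclic_code n g" if "c \<in> cyclic_code n g" "d \<in> cyclic_code n g" for c d
      using that by (auto simp: code)
    fix c assume c: "c \<in> cyclic_code n g" "c \<noteq> 0"
    have "\<delta> \<le> card {i. coeff (map_poly h c) i \<noteq> 0}"
    proof (rule bch_bound[OF inj \<beta>0])
      show "map_poly h c \<noteq> 0" using c(2) by simp
      show "\<forall>i\<ge>n. coeff (map_poly h c) i = 0" using c(1) by (simp add: code)
      fix j assume j: "j \<in> {1..\<delta> - 1}"
      have "j mod n \<in> cyclotomic_coset q m n j" unfolding coset by (rule exI[of _ 0]) simp
      hence "\<beta> ^ (j mod n) \<in> S" using j unfolding S_def J(1) by (intro imageI UN_I[of j])
      moreover have "g dvd c" using c(1) by (simp add: code)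
      ultimately show "poly (map_poly h c) (\<beta> ^ j) = 0"
        unfolding g_def vanishing_poly_dvd_iff[OF S] \<beta>_mod by blast
    qed
    thus "\<delta> \<le> card {i. coeff c i \<noteq> 0}" by simp
  qed
qed

text \<open>Exponents can be reduced modulo the number of nonzero elements, so that many powers
  already cover all of them and must be distinct.\<close>

lemma mult_generator_power_inj:
  fixes \<alpha> :: "'l::{field,finite}"
  assumes "mult_generator \<alpha>"
  shows "\<alpha> ^ (CARD('l) - 1) = 1" "inj_on (\<lambda>i. \<alpha> ^ i) {..<CARD('l) - 1}"
proof -
  define N where "N = CARD('l) - 1"
  have range: "range (\<lambda>k::nat. \<alpha> ^ k) = UNIV - {0}"
    using assms by (simp add: mult_generator_def)
  hence "\<alpha> ^ 1 \<in> UNIV - {0}" by blast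
  hence 1: "\<alpha> ^ N = 1" unfolding N_def by (intro power_card_minus_1) simp
  have "card {0, 1 :: 'l} \<le> CARD('l)" by (intro card_mono) auto
  hence "N > 0" by (simp add: N_def)
  have mod: "\<alpha> ^ k = \<alpha> ^ (k mod N)" for k
  proof -
    have "\<alpha> ^ k = \<alpha> ^ (N * (k div N) + k mod N)" by simp
    also have "\<dots> = \<alpha> ^ (k mod N)"
      by (simp only: power_add power_mult 1 power_one mult_1)
    finally show ?thesis .
  qed
  have "range (\<lambda>k::nat. \<alpha> ^ k) \<subseteq> (\<lambda>k. \<alpha> ^ k) ` {..<N}"
  proof safe
    fix k
    show "\<alpha> ^ k \<in> (\<lambda>k. \<alpha> ^ k) ` {..<N}"
      unfolding mod[of k] using \<open>N > 0\<close> by (intro imageI) simp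
  qed
  from subset_antisym[OF image_mono[OF subset_UNIV] this]
  have "(\<lambda>k. \<alpha> ^ k) ` {..<N} = UNIV - {0}" unfolding range .
  hence "card ((\<lambda>k. \<alpha> ^ k) ` {..<N}) = N" by (simp add: card_Diff_singleton N_def)
  hence "inj_on (\<lambda>i. \<alpha> ^ i) {..<N}" by (intro eq_card_imp_inj_on) auto
  thus "\<alpha> ^ (CARD('l) - 1) = 1" "inj_on (\<lambda>i. \<alpha> ^ i) {..<CARD('l) - 1}"
    using 1 by (simp_all add: N_def)
qed

theorem theorem33:
  fixes h :: "'k::{field,finite} \<Rightarrow> 'l::{field,finite}"
    and \<alpha> \<beta> :: 'l
    and q m n a b \<delta>1 \<delta>2 :: nat
  assumes "primepow q" and "q > 3" and "m \<ge> q"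
    and "n = (q ^ m - 1) div (q - 1)"
    and "m - 1 = a * (q - 1) + b" and "a \<ge> 1" and "b \<le> q - 2"
    and "(b = 0 \<and> a \<ge> 3) \<or> b \<in> {1, 2, q - 4, q - 3, q - 2}"
    and "CARD('k) = q" and "CARD('l) = q ^ m" and "field_hom h"
    and "mult_generator \<alpha>" and "\<beta> = \<alpha> ^ (q - 1)"
    and "\<delta>1 = nth_largest_leader q m n 1" and "\<delta>2 = nth_largest_leader q m n 2"
  shows "(\<forall>\<delta>. \<delta>2 + 1 \<le> \<delta> \<and> \<delta> \<le> \<delta>1 \<longrightarrow>
            linear_code n (bch_code h n \<beta> \<delta>) \<and>
            code_dim (bch_code h n \<beta> \<delta>) = m div gcd m (q - 1) + 1 \<and>
            min_dist (bch_code h n \<beta> \<delta>) \<ge> \<delta>) \<and>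
         (linear_code n (bch_code h n \<beta> \<delta>2) \<and>
          code_dim (bch_code h n \<beta> \<delta>2) = m div gcd m (q - 1) + m + 1 \<and>
          min_dist (bch_code h n \<beta> \<delta>2) \<ge> \<delta>2)"
proof -
  interpret repunit q m n "q - 1" using assms(2-4) by unfold_locales auto
  interpret finite_field_extension h q
    using assms(1,9,11) by (simp add: finite_field_extension_def finite_field_extension_axioms_def)
  let ?C = "cyclotomic_coset q m n"
  have card_l: "CARD('l) - 1 = (q - 1) * n" using p_n assms(10) by simp
  note \<alpha> = mult_generator_power_inj[OF assms(12), unfolded card_l]
  have \<beta>n: "\<beta> ^ n = 1" using \<alpha>(1) by (simp add: assms(13) power_mult)
  \<comment> \<open>The exponents \<open>(q - 1) * i\<close> with \<open>i < n\<close> stay below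
    \<open>(q - 1) * n\<close>, the number of nonzero elements.\<close>
  have \<beta>inj: "inj_on (\<lambda>i. \<beta> ^ i) {..<n}"
  proof (rule inj_onI)
    fix i j assume ij: "i \<in> {..<n}" "j \<in> {..<n}" "\<beta> ^ i = \<beta> ^ j"
    hence "(q - 1) * i = (q - 1) * j"
      using p_pos by (intro inj_onD[OF \<alpha>(2)]) (auto simp: assms(13) power_mult)
    thus "i = j" using assms(2) by simp
  qed
  obtain l1 l2 where l12: "nth_largest_leader q m n 1 = l1" "nth_largest_leader q m n 2 = l2"
    and l: "0 < l2" "l2 < l1" "l1 < n"
    and card: "card (?C l1) = m div gcd m (q - 1)" "card (?C l2) = m"
    and l2_l1: "l2 \<notin> ?C l1"
    and min1: "\<And>x. x \<in> ?C l1 \<Longrightarrow> l1 \<le> x"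
      and min2: "\<And>x. x \<in> ?C l2 \<Longrightarrow> l2 \<le> x"
    and rest: "\<And>t. 0 < t \<Longrightarrow> t < n \<Longrightarrow> t \<notin> ?C l1 \<Longrightarrow> t \<notin> ?C l2 \<Longrightarrow> \<exists>x\<in>?C t. x < l2"
    using coset_leaders_top_two by metis
  have n0: "n > 0" using l by simp
  have in_range: "0 < x \<and> x < n" if "x \<in> ?C i" "0 < i" "i < n" for x i
    using that shift_pos[of i] shift_less by (auto simp: mem_coset_iff)
  have sub: "?C l1 \<subseteq> {1..<n}" "?C l2 \<subseteq> {1..<n}"
    using in_range[of _ l1] in_range[of _ l2] l by force+
  have disj: "?C l1 \<inter> ?C l2 = {}"
    using l2_l1 mem_coset_trans mem_coset_sym l by (metis disjoint_iff less_trans)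
  have fin: "finite (?C i)" for i by (simp add: cyclotomic_coset_def)
  \<comment> \<open>The exponents of the zeros for designed distance \<open>\<delta>\<close>.
    Exponent 0 never occurs, which accounts for the summand 1 in both dimensions.\<close>
  define U where "U \<delta> = (\<Union>i\<in>{1..\<delta> - 1}. ?C i)" for \<delta>
  note params = bch_code_parameters[OF \<beta>inj \<beta>n n0 mem_coset_iff refl]
  have U_sub: "U \<delta> \<subseteq> {1..<n} - ?C l1" if \<delta>: "\<delta> \<le> l1" for \<delta>
  proof
    fix x assume "x \<in> U \<delta>"
    then obtain i where i: "i \<in> {1..\<delta> - 1}" "x \<in> ?C i" by (auto simp: U_def)
    have "0 < i" "i < n" "i < l1" using i \<delta> l by auto
    moreover have "x \<notin> ?C l1"
    proof
      assume "x \<in> ?C l1"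
      hence "i \<in> ?C l1"
        using mem_coset_trans[OF mem_coset_sym[OF i(2)]] \<open>i < n\<close> by blast
      thus False using min1 \<open>i < l1\<close> by fastforce
    qed
    ultimately show "x \<in> {1..<n} - ?C l1" using in_range[OF i(2)] by simp
  qed
  have rest_U: "t \<in> U \<delta>" if t: "t \<in> {1..<n} - ?C l1 - ?C l2"
    and \<delta>: "l2 \<le> \<delta>" for t \<delta>
  proof -
    obtain x where x: "x \<in> ?C t" "x < l2" using rest[of t] t by auto
    have "0 < x" using in_range[OF x(1)] t by simp
    moreover have "t \<in> ?C x" using mem_coset_sym[OF x(1)] t by simp
    ultimately show ?thesis using x \<delta> unfolding U_def by (intro UN_I[of x]) auto
  qed
  have 1: "linear_code n (bch_code h n \<beta> \<delta>) \<and>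
      code_dim (bch_code h n \<beta> \<delta>) = m div gcd m (q - 1) + 1 \<and>
      min_dist (bch_code h n \<beta> \<delta>) \<ge> \<delta>" if \<delta>: "l2 + 1 \<le> \<delta>" "\<delta> \<le> l1" for \<delta>
  proof -
    \<comment> \<open>Now \<open>l2\<close> itself is one of the indices
      \<open>1..\<delta> - 1\<close>.\<close>
    have C_l2: "t \<in> U \<delta>" if "t \<in> ?C l2" for t
      using that \<delta> l unfolding U_def by (intro UN_I[of l2]) auto
    have "U \<delta> = {1..<n} - ?C l1"
    proof
      show "{1..<n} - ?C l1 \<subseteq> U \<delta>"
      proof
        fix t assume "t \<in> {1..<n} - ?C l1"
        thus "t \<in> U \<delta>"
          using C_l2 rest_U[of t \<delta>] \<delta> by (cases "t \<in> ?C l2") simp_all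
      qed
    qed (rule U_sub[OF \<delta>(2)])
    hence "card (U \<delta>) = (n - 1) - m div gcd m (q - 1)"
      using sub fin by (simp add: card_Diff_subset card)
    moreover have "m div gcd m (q - 1) \<le> n - 1" using card_mono[OF _ sub(1)] by (simp add: card)
    ultimately show ?thesis using params[of \<delta>] n0 unfolding U_def[symmetric] by simp
  qed
  \<comment> \<open>The indices stop at \<open>l2 - 1\<close>, just short of the leader, so the
    coset of \<open>l2\<close> stays outside and adds \<open>m\<close> to the dimension.\<close>
  have "U l2 = {1..<n} - (?C l1 \<union> ?C l2)"
  proof -
    have "x \<notin> ?C l2" if xU: "x \<in> U l2" for x
    proof
      assume x: "x \<in> ?C l2"
      obtain i where i: "i \<in> {1..l2 - 1}" "x \<in> ?C i" using xU by (auto simp: U_def)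
      have "i < n" using i(1) l by auto
      hence "i \<in> ?C l2" using mem_coset_trans[OF mem_coset_sym[OF i(2)] x] by simp
      thus False using min2 i by fastforce
    qed
    moreover have "{1..<n} - (?C l1 \<union> ?C l2) \<subseteq> U l2"
      using rest_U[of _ l2] by blast
    moreover have "U l2 \<subseteq> {1..<n} - ?C l1" using U_sub[of l2] l by simp
    ultimately show ?thesis by blast
  qed
  moreover have "card (?C l1 \<union> ?C l2) = m div gcd m (q - 1) + m"
    using card_Un_disjoint[OF fin fin disj] by (simp add: card)
  moreover have "card (?C l1 \<union> ?C l2) \<le> n - 1"
    using card_mono[of "{1..<n}" "?C l1 \<union> ?C l2"] sub by simp
  ultimately have "card (U l2) = (n - 1) - (m div gcd m (q - 1) + m)" "m div gcd m (q - 1) + m \<le> n - 1"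
    using sub fin by (simp_all add: card_Diff_subset)
  hence "linear_code n (bch_code h n \<beta> l2) \<and>
      code_dim (bch_code h n \<beta> l2) = m div gcd m (q - 1) + m + 1 \<and>
      min_dist (bch_code h n \<beta> l2) \<ge> l2"
    using params[of l2] n0 unfolding U_def[symmetric] by simp
  with 1 show ?thesis unfolding assms(14,15) l12 by blast
qed

end
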